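(* For any $\alpha \in (0, 0.3624)$, the condition number of $P_{l}^{-1} \tilde{\mathcal{M}} P_{r}^{-1}$ is bounded, namely $$\kappa_2\left(P_{l}^{-1} \tilde{\mathcal{M}} P_{r}^{-1}\right) < 2\sqrt{3}.$$ Here $\tilde{\mathcal{M}} = (\kappa G_{\beta}) \otimes I_t + I_x \otimes A_t$, $P_{l} = (\kappa G_{\tau})^{-1/2} \otimes A_t + (\kappa G_{\tau})^{1/2} \otimes I_t$ and $P_{r} = (\kappa G_{\tau})^{1/2} \otimes I_t$ are the matrices defined in the context, for arbitrary parameters $1<\beta\le 2$, $\kappa>0$, $x_L<x_R$, $T>0$ and integers $N, M\ge 2$; the bound does not depend on these parameters.
   Context: Parameters: real $\alpha\in(0,1)$, $1<\beta\le 2$, $\kappa>0$, $x_L<x_R$, $T>0$; integers $N,M\ge 2$; $h=(x_R-x_L)/N$, $\tau_t=T/M$. $I_t$ and $I_x$ are the identity matrices of orders $M-1$ and $N-1$. $\otimes$ is the Kronecker product, and for a nonsingular matrix $A$, $\kappa_2(A)=\|A^{-1}\|_2\|A\|_2$ (spectral norm). Temporal coefficients. For $\ell\ge 0$ let $a_\ell^{(\alpha)}=(\ell+1)^{1-\alpha}-\ell^{1-\alpha}$ and $b_\ell^{(\alpha)}=\frac{1}{2-\alpha}\left[(\ell+1)^{2-\alpha}-\ell^{2-\alpha}\right]-\frac12\left[(\ell+1)^{1-\alpha}+\ell^{1-\alpha}\right]$. Let $c_0^{(\alpha)}=a_0^{(\alpha)}+b_0^{(\alpha)}$, $c_s^{(\alpha)}=a_s^{(\alpha)}+b_s^{(\alpha)}-b_{s-1}^{(\alpha)}$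 for $s\ge1$; $\tilde c_0^{(\alpha)}=a_0^{(\alpha)}+b_0^{(\alpha)}+b_1^{(\alpha)}$, $\tilde c_k^{(\alpha)}=a_k^{(\alpha)}+b_k^{(\alpha)}+b_{k+1}^{(\alpha)}-b_{k-1}^{(\alpha)}$ for $k\ge 1$. Temporal matrix. With $\sigma=\frac{h^\beta\tau_t^{-\alpha}}{\Gamma(2-\alpha)}$, $A_t$ is the $(M-1)\times(M-1)$ lower triangular block matrix $$A_t=\begin{bmatrix} A_{11} & \mathbf 0 \\ A_{12} & A_{22} \end{bmatrix},$$ where $A_{11}=\sigma\tilde c_0^{(\alpha)}$ is a scalar, $A_{12}=\sigma\left[\tilde c_1^{(\alpha)}-c_0^{(\alpha)},\tilde c_2^{(\alpha)}-c_1^{(\alpha)},\ldots,\tilde c_{M-2}^{(\alpha)}-c_{M-3}^{(\alpha)}\right]^T$ is a column of length $M-2$, and $A_{22}$ is the $(M-2)\times(M-2)$ lower triangular Toeplitz matrix with diagonal entries $\sigma c_0^{(\alpha)}$ and entries $\sigma\,(c_k^{(\alpha)}-c_{k-1}^{(\alpha)})$ on the $k$-th subdiagonal, $1\le k\le M-3$. Spatial matrices. For $k\in\mathbb Z$ let $g_k^\beta=\frac{(-1)^k\Gamma(1+\beta)}{\Gamma(\beta/2-k+1)\Gamma(\beta/2+k+1)}$ (with $1/\Gamma=0$ at the poles of $\Gamma$). $G_\beta=(g_{i-j}^\beta)_{1\le i,j\le N-1}$ is a symmetric positive definite Toeplitz matrix. $H_\beta$ is the $(N-1)\times(N-1)$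 Hankel matrix whose successive antidiagonals ($i+j=2,3,\ldots,2N-2$) carry the values $g_2^\beta,g_3^\beta,\ldots,g_{N-2}^\beta,0,0,0,g_{N-2}^\beta,\ldots,g_3^\beta,g_2^\beta$; i.e. the $(i,j)$ entry is $g_{i+j}^\beta$ if $i+j\le N-2$, $0$ if $i+j\in\{N-1,N,N+1\}$, and $g_{2N-(i+j)}^\beta$ if $i+j\ge N+2$. $G_\tau=G_\beta-H_\beta$; it is symmetric positive definite, and $(\kappa G_\tau)^{1/2}$ is the symmetric positive definite square root of $\kappa G_\tau$, with inverse $(\kappa G_\tau)^{-1/2}$. The matrices $P_l$ and $P_r$ are nonsingular. *)

theory Defs
  imports
    "HOL-Analysis.Gamma_Function"
    "Jordan_Normal_Form.Gauss_Jordan_Elimination"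
begin

text \<open>
  Matrices are those of \<^theory>\<open>Jordan_Normal_Form.Matrix\<close>, whose rows and columns are numbered
  from 0; the entry at position \<open>(i, j)\<close> below is the entry \<open>(i + 1, j + 1)\<close> in the usual
  numbering.
\<close>

definition kronecker :: "real mat \<Rightarrow> real mat \<Rightarrow> real mat" where
  "kronecker A B =
     Matrix.mat (dim_row A * dim_row B) (dim_col A * dim_col B)
       (\<lambda>(i, j). A $$ (i div dim_row B, j div dim_col B) * B $$ (i mod dim_row B, j mod dim_col B))"

definition matrix_inverse :: "real mat \<Rightarrow> real mat" where
  "matrix_inverse A = the (mat_inverse A)"

definition euclidean_norm :: "real Matrix.vec \<Rightarrow> real" where
  "euclidean_norm v = sqrt (scalar_prod v v)"

text \<open>
  As in \<^const>\<open>onorm\<close>, the zero vector contributes \<open>0 / 0 = 0\<close> to the supremum.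
\<close>
definition spectral_norm :: "real mat \<Rightarrow> real" where
  "spectral_norm A =
     (SUP v \<in> carrier_vec (dim_col A). euclidean_norm (A *\<^sub>v v) / euclidean_norm v)"

text \<open>Meaningful only for a nonsingular matrix.\<close>
definition condition_number :: "real mat \<Rightarrow> real" where
  "condition_number A = spectral_norm (matrix_inverse A) * spectral_norm A"

definition sym_pos_def :: "real mat \<Rightarrow> bool" where
  "sym_pos_def A \<longleftrightarrow>
     square_mat A \<and> transpose_mat A = A \<and>
     (\<forall>v \<in> carrier_vec (dim_row A). v \<noteq> 0\<^sub>v (dim_row A) \<longrightarrow> scalar_prod v (A *\<^sub>v v) > 0)"

text \<open>For a symmetric positive definite \<open>A\<close>, exactly one such \<open>S\<close> exists.\<close>
definition spd_sqrt :: "real mat \<Rightarrow> real mat" where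
  "spd_sqrt A = (SOME S. sym_pos_def S \<and> S * S = A)"

definition a_coeff :: "real \<Rightarrow> nat \<Rightarrow> real" where
  "a_coeff \<alpha> l = (real l + 1) powr (1 - \<alpha>) - real l powr (1 - \<alpha>)"

definition b_coeff :: "real \<Rightarrow> nat \<Rightarrow> real" where
  "b_coeff \<alpha> l =
     1 / (2 - \<alpha>) * ((real l + 1) powr (2 - \<alpha>) - real l powr (2 - \<alpha>))
     - 1 / 2 * ((real l + 1) powr (1 - \<alpha>) + real l powr (1 - \<alpha>))"

definition c_coeff :: "real \<Rightarrow> nat \<Rightarrow> real" where
  "c_coeff \<alpha> s =
     (if s = 0 then a_coeff \<alpha> 0 + b_coeff \<alpha> 0
      else a_coeff \<alpha> s + b_coeff \<alpha> s - b_coeff \<alpha> (s - 1))"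

definition c_tilde_coeff :: "real \<Rightarrow> nat \<Rightarrow> real" where
  "c_tilde_coeff \<alpha> k =
     (if k = 0 then a_coeff \<alpha> 0 + b_coeff \<alpha> 0 + b_coeff \<alpha> 1
      else a_coeff \<alpha> k + b_coeff \<alpha> k + b_coeff \<alpha> (k + 1) - b_coeff \<alpha> (k - 1))"

definition A_t :: "real \<Rightarrow> real \<Rightarrow> nat \<Rightarrow> real mat" where
  "A_t \<alpha> \<sigma> M =
     four_block_mat
       (Matrix.mat 1 1 (\<lambda>_. \<sigma> * c_tilde_coeff \<alpha> 0))
       (0\<^sub>m 1 (M - 2))
       (Matrix.mat (M - 2) 1 (\<lambda>(i, _). \<sigma> * (c_tilde_coeff \<alpha> (i + 1) - c_coeff \<alpha> i)))
       (Matrix.mat (M - 2) (M - 2)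
         (\<lambda>(i, j). if i < j then 0
                   else if i = j then \<sigma> * c_coeff \<alpha> 0
                   else \<sigma> * (c_coeff \<alpha> (i - j) - c_coeff \<alpha> (i - j - 1))))"

text \<open>\<^const>\<open>rGamma\<close> is \<open>1 / \<Gamma>\<close>, extended by 0 to the poles of \<open>\<Gamma>\<close>.\<close>
definition g_coeff :: "real \<Rightarrow> int \<Rightarrow> real" where
  "g_coeff \<beta> k =
     (-1) powi k * Gamma (1 + \<beta>)
       * rGamma (\<beta> / 2 - of_int k + 1) * rGamma (\<beta> / 2 + of_int k + 1)"

definition G_beta :: "real \<Rightarrow> nat \<Rightarrow> real mat" where
  "G_beta \<beta> N = Matrix.mat (N - 1) (N - 1) (\<lambda>(i, j). g_coeff \<beta> (int i - int j))"

text \<open>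
  The sum \<open>s\<close> is that of the indices counted from 1. The comparisons are additive because
  subtraction on \<^typ>\<open>nat\<close> truncates.
\<close>
definition H_beta :: "real \<Rightarrow> nat \<Rightarrow> real mat" where
  "H_beta \<beta> N =
     Matrix.mat (N - 1) (N - 1)
       (\<lambda>(i, j). let s = (i + 1) + (j + 1) in
          if s + 2 \<le> N then g_coeff \<beta> (int s)
          else if s \<le> N + 1 then 0
          else g_coeff \<beta> (2 * int N - int s))"

definition G_tau :: "real \<Rightarrow> nat \<Rightarrow> real mat" where
  "G_tau \<beta> N = G_beta \<beta> N - H_beta \<beta> N"

end

theory Submission
  imports Defs "Jordan_Normal_Form.Spectral_Radius"
begin

text \<open>
  Put \<open>K = \<kappa> G\<^sub>\<tau> = S\<^sup>2\<close> and \<open>R = S\<^sup>-\<^sup>1\<close>, and let \<open>E = (R \<kappa> G\<^sub>\<beta> R) \<otimes> I\<close> and \<open>B = R\<^sup>2 \<otimes> A\<^sub>t\<close>. Then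
  \<open>P\<^sub>l = (S \<otimes> I) (1 + B)\<close> and \<open>Mtilde P\<^sub>r\<^sup>-\<^sup>1 = (S \<otimes> I) (E + B)\<close>, so that the preconditioned matrix is
  \<open>X = (1 + B)\<^sup>-\<^sup>1 (E + B)\<close>. Two facts bound its condition number: \<open>B\<close> is accretive, that is
  \<open>v \<bullet> B v \<ge> 0\<close>, and the symmetric matrix \<open>E\<close> has its quadratic form between \<open>1/2\<close> and \<open>3/2\<close>. The
  first gives \<open>\<parallel>(1 + B)\<^sup>-\<^sup>1\<parallel> \<le> 1\<close>, both together give \<open>\<parallel>(E + B)\<^sup>-\<^sup>1\<parallel> \<le> 2\<close>, and the second gives
  \<open>\<parallel>E - 1\<parallel> \<le> 1/2\<close>. From \<open>X = 1 + (1 + B)\<^sup>-\<^sup>1 (E - 1)\<close> and \<open>X\<^sup>-\<^sup>1 = 1 + (E + B)\<^sup>-\<^sup>1 (1 - E)\<close> one reads off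
  \<open>\<parallel>X\<parallel> \<le> 3/2\<close> and \<open>\<parallel>X\<^sup>-\<^sup>1\<parallel> \<le> 2\<close>. Hence the condition number is at most 3, which is below \<open>2 \<surd>3\<close>
  (\<open>near_identity_condition\<close>, \<open>preconditioned_condition\<close>).

  Both facts are obtained from diagonal dominance. The bounds on \<open>E\<close> say that \<open>G\<^sub>\<beta> + H\<^sub>\<beta>\<close> and
  \<open>G\<^sub>\<beta> - 3 H\<^sub>\<beta>\<close> are positive semidefinite. The coefficients \<open>g\<^sub>k\<close> are nonpositive and nondecreasing for
  \<open>k \<ge> 1\<close>, and twice the sum of any initial segment of them is at least \<open>-g\<^sub>0\<close>. The off-diagonal
  entries of a row of \<open>G\<^sub>\<beta>\<close> and the entries of the same row of \<open>H\<^sub>\<beta>\<close> are together taken from two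
  such segments, without repetition within either (\<open>row_sum_G_H_le\<close>), so the absolute values in
  the row add up to at most \<open>g\<^sub>0\<close>. The same estimate, which is strict in
  the first row, makes \<open>G\<^sub>\<tau>\<close> positive definite.

  For \<open>A\<^sub>t\<close>, dominance of the symmetric part follows by telescoping once the coefficients
  \<open>c\<^sub>k\<close> are nonincreasing (\<open>c_coeff_Suc_le\<close>). From \<open>c\<^sub>2\<close> on this is a comparison of second differences
  with room to spare; the inequality \<open>c\<^sub>1 \<ge> c\<^sub>2\<close> is the tight one. It is lost once \<open>\<alpha>\<close>
  exceeds a number near \<open>0.374\<close>, and the hypothesis on \<open>\<alpha>\<close> excludes this
  (\<open>powr_two_three_gap_nonneg\<close>).

  The square root \<open>S\<close> is available because a real symmetric matrix has a real eigenvector, which a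
  Householder reflection splits off (\<open>sym_pos_def_has_sqrt\<close>).
\<close>

section \<open>Quadratic forms and inverses of real matrices\<close>

lemma scalar_prod_self: "scalar_prod v v = (\<Sum>i<dim_vec v. (v $ i)\<^sup>2)" for v :: "real Matrix.vec"
  by (simp add: scalar_prod_def power2_eq_square atLeast0LessThan)

lemma scalar_prod_self_nonneg: "0 \<le> scalar_prod v v" for v :: "real Matrix.vec"
  by (simp add: scalar_prod_self sum_nonneg)

lemma scalar_prod_self_eq_0:
  fixes v :: "real Matrix.vec"
  assumes "v \<in> carrier_vec n"
  shows "scalar_prod v v = 0 \<longleftrightarrow> v = 0\<^sub>v n"
  using assms by (auto simp: scalar_prod_self sum_nonneg_eq_0_iff vec_eq_iff)

lemma quadratic_form_eq_sum:
  fixes A :: "real mat"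
  assumes "A \<in> carrier_mat n n" "v \<in> carrier_vec n"
  shows "scalar_prod v (A *\<^sub>v v) = (\<Sum>i<n. \<Sum>j<n. v $ i * A $$ (i, j) * v $ j)"
  using assms by (simp add: scalar_prod_def atLeast0LessThan sum_distrib_left mult_ac)

lemma smult_form:
  fixes A :: "real mat"
  assumes "A \<in> carrier_mat n n" "v \<in> carrier_vec n"
  shows "scalar_prod v ((c \<cdot>\<^sub>m A) *\<^sub>v v) = c * scalar_prod v (A *\<^sub>v v)"
proof -
  have "c \<cdot>\<^sub>m A \<in> carrier_mat n n" using assms by simp
  from quadratic_form_eq_sum[OF this assms(2)] show ?thesis
    unfolding quadratic_form_eq_sum[OF assms] using assms by (simp add: sum_distrib_left mult_ac)
qed

lemma symmetric_index:
  assumes "A \<in> carrier_mat n n" "transpose_mat A = A" "i < n" "j < n"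
  shows "A $$ (i, j) = A $$ (j, i)"
proof -
  have "A $$ (i, j) = transpose_mat A $$ (i, j)" by (simp only: assms(2))
  then show ?thesis using assms(1,3,4) by simp
qed

lemma symmetric_swap:
  fixes A :: "real mat"
  assumes "A \<in> carrier_mat n n" "transpose_mat A = A" "u \<in> carrier_vec n" "v \<in> carrier_vec n"
  shows "scalar_prod u (A *\<^sub>v v) = scalar_prod v (A *\<^sub>v u)"
  using transpose_vec_mult_scalar[OF assms(1,4,3)] assms
  by (simp add: comm_scalar_prod[of _ n])

text \<open>
  Only congruences by a symmetric \<open>W\<close> occur below, so \<open>W\<close> stands in place of its transpose.
\<close>

lemma congruence_form:
  fixes A W :: "real mat"
  assumes W: "W \<in> carrier_mat n n" "transpose_mat W = W" and A: "A \<in> carrier_mat n n"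
    and v: "v \<in> carrier_vec n"
  shows "scalar_prod v ((W * A * W) *\<^sub>v v) = scalar_prod (W *\<^sub>v v) (A *\<^sub>v (W *\<^sub>v v))"
proof -
  have "(W * A * W) *\<^sub>v v = W *\<^sub>v (A *\<^sub>v (W *\<^sub>v v))"
    using W A v by (simp add: assoc_mult_mat_vec[of _ n n _ n])
  then show ?thesis
    using symmetric_swap[OF W v, of "A *\<^sub>v (W *\<^sub>v v)"] W A v
    by (simp add: comm_scalar_prod[of _ n])
qed

lemma congruence_symmetric:
  fixes A W :: "real mat"
  assumes "W \<in> carrier_mat n n" "transpose_mat W = W" "A \<in> carrier_mat n n" "transpose_mat A = A"
  shows "transpose_mat (W * A * W) = W * A * W"
  using assms by (simp add: transpose_mult[of _ n n _ n] assoc_mult_mat[of _ n n _ n _ n])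

lemma det_nonzero_if_injective:
  fixes A :: "real mat"
  assumes "A \<in> carrier_mat n n" "\<And>v. v \<in> carrier_vec n \<Longrightarrow> A *\<^sub>v v = 0\<^sub>v n \<Longrightarrow> v = 0\<^sub>v n"
  shows "det A \<noteq> 0"
  using det_0_iff_vec_prod_zero[OF assms(1)] assms(2) by blast

lemma det_nonzero_if_right_inverse:
  fixes A :: "real mat"
  assumes A: "A \<in> carrier_mat n n" and B: "B \<in> carrier_mat n n" and AB: "A * B = 1\<^sub>m n"
  shows "det A \<noteq> 0"
  using det_mult[OF A B] AB by auto

lemma matrix_inverse_det:
  assumes A: "A \<in> carrier_mat n n" and det: "det A \<noteq> 0"
  shows "matrix_inverse A \<in> carrier_mat n n" "A * matrix_inverse A = 1\<^sub>m n" "matrix_inverse A * A = 1\<^sub>m n"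
proof -
  have "A \<in> Units (ring_mat TYPE(real) n ())"
    using det_non_zero_imp_unit[OF A det] .
  then obtain B where B: "mat_inverse A = Some B"
    using mat_inverse(1)[OF A, where b = "()"] by (cases "mat_inverse A") auto
  then show "matrix_inverse A \<in> carrier_mat n n" "A * matrix_inverse A = 1\<^sub>m n" "matrix_inverse A * A = 1\<^sub>m n"
    using mat_inverse(2)[OF A B] by (simp_all add: matrix_inverse_def)
qed

lemma matrix_inverse_eqI:
  assumes A: "A \<in> carrier_mat n n" and B: "B \<in> carrier_mat n n" and AB: "A * B = 1\<^sub>m n"
  shows "matrix_inverse A = B"
proof -
  note inv = matrix_inverse_det[OF A det_nonzero_if_right_inverse[OF A B AB]]
  have "matrix_inverse A = matrix_inverse A * (A * B)"
    using inv AB by simp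
  also have "\<dots> = B"
    using inv A B by (subst assoc_mult_mat[symmetric]) auto
  finally show ?thesis .
qed

lemma matrix_inverse_symmetric:
  assumes A: "A \<in> carrier_mat n n" "transpose_mat A = A" and det: "det A \<noteq> 0"
  shows "transpose_mat (matrix_inverse A) = matrix_inverse A"
proof -
  note inv = matrix_inverse_det[OF A(1) det]
  have "A * transpose_mat (matrix_inverse A) = transpose_mat (matrix_inverse A * A)"
    using inv A by (subst transpose_mult[of _ n n _ n]) auto
  also have "\<dots> = 1\<^sub>m n" using inv by simp
  finally have right_inverse: "A * transpose_mat (matrix_inverse A) = 1\<^sub>m n" .
  show ?thesis
    by (rule matrix_inverse_eqI[OF A(1) _ right_inverse, symmetric]) (use inv(1) in simp)
qed

lemma invertible_mat_if_det_nonzero: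
  fixes A :: "real mat"
  assumes A: "A \<in> carrier_mat n n" and det: "det A \<noteq> 0"
  shows "invertible_mat A"
  using matrix_inverse_det[OF assms] A unfolding invertible_mat_def inverts_mat_def by auto

lemma sym_pos_def_det_nonzero:
  assumes "A \<in> carrier_mat n n" "sym_pos_def A"
  shows "det A \<noteq> 0"
proof (rule det_nonzero_if_injective[OF assms(1)])
  fix v assume v: "v \<in> carrier_vec n" "A *\<^sub>v v = 0\<^sub>v n"
  then have "scalar_prod v (A *\<^sub>v v) = 0" by simp
  then show "v = 0\<^sub>v n" using assms v unfolding sym_pos_def_def by force
qed

lemma sym_pos_def_smult:
  fixes A :: "real mat"
  assumes "A \<in> carrier_mat n n" "sym_pos_def A" "0 < c"
  shows "sym_pos_def (c \<cdot>\<^sub>m A)"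
proof -
  have "transpose_mat (c \<cdot>\<^sub>m A) = c \<cdot>\<^sub>m transpose_mat A" by (rule eq_matI) auto
  then show ?thesis
    using assms unfolding sym_pos_def_def by (auto simp: smult_form[OF assms(1)])
qed

lemma sym_pos_def_congruence:
  assumes W: "W \<in> carrier_mat n n" "transpose_mat W = W" "W * W = 1\<^sub>m n"
    and A: "A \<in> carrier_mat n n" "sym_pos_def A"
  shows "sym_pos_def (W * A * W)"
proof -
  have "0 < scalar_prod v ((W * A * W) *\<^sub>v v)" if v: "v \<in> carrier_vec n" "v \<noteq> 0\<^sub>v n" for v
  proof -
    have "W *\<^sub>v (W *\<^sub>v v) = v"
      using W v by (simp flip: assoc_mult_mat_vec)
    moreover have "W *\<^sub>v 0\<^sub>v n = 0\<^sub>v n" using W by (intro eq_vecI) auto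
    ultimately have "W *\<^sub>v v \<noteq> 0\<^sub>v n" using v(2) by metis
    then show ?thesis
      unfolding congruence_form[OF W(1,2) A(1) v(1)]
      using A W v unfolding sym_pos_def_def by auto
  qed
  moreover have "transpose_mat (W * A * W) = W * A * W"
    using A W by (intro congruence_symmetric) (auto simp: sym_pos_def_def)
  ultimately show ?thesis
    using W A unfolding sym_pos_def_def by auto
qed

section \<open>Perturbing the identity by an accretive matrix\<close>

text \<open>
  A symmetric matrix is bounded by its numerical range. By polarization,
  \<open>4 (u \<bullet> D v) = (u + v) \<bullet> D (u + v) - (u - v) \<bullet> D (u - v)\<close>, which the hypothesis and the
  parallelogram law bound by \<open>2 c (u \<bullet> u + v \<bullet> v)\<close>; the choice \<open>u = D v / c\<close> gives the claim.
\<close>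

lemma symmetric_form_bound_imp_norm_bound:
  fixes D :: "real mat"
  assumes D: "D \<in> carrier_mat n n" "transpose_mat D = D" and c: "0 < c"
    and bound: "\<And>v. v \<in> carrier_vec n \<Longrightarrow> \<bar>scalar_prod v (D *\<^sub>v v)\<bar> \<le> c * scalar_prod v v"
    and v: "v \<in> carrier_vec n"
  shows "scalar_prod (D *\<^sub>v v) (D *\<^sub>v v) \<le> c\<^sup>2 * scalar_prod v v"
proof -
  define w where "w = D *\<^sub>v v"
  define u where "u = (1 / c) \<cdot>\<^sub>v w"
  have w: "w \<in> carrier_vec n" and u: "u \<in> carrier_vec n"
    using D v by (simp_all add: w_def u_def)
  have Du: "D *\<^sub>v u \<in> carrier_vec n" using D u by simp
  have swap: "scalar_prod v (D *\<^sub>v u) = scalar_prod u w"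
    using symmetric_swap[OF D u v] by (simp add: w_def)
  have plus: "scalar_prod (u + v) (D *\<^sub>v (u + v))
     = scalar_prod u (D *\<^sub>v u) + 2 * scalar_prod u w + scalar_prod v w"
    using u v w Du swap D
    by (simp add: mult_add_distrib_mat_vec[OF D(1)] add_scalar_prod_distrib[of _ n] scalar_prod_add_distrib[of _ n] flip: w_def)
  have minus: "scalar_prod (u - v) (D *\<^sub>v (u - v))
     = scalar_prod u (D *\<^sub>v u) - 2 * scalar_prod u w + scalar_prod v w"
    using u v w Du swap D
    by (simp add: mult_minus_distrib_mat_vec[OF D(1)] minus_scalar_prod_distrib[of _ n] scalar_prod_minus_distrib[of _ n] flip: w_def)
  have norms: "scalar_prod (u + v) (u + v) + scalar_prod (u - v) (u - v) = 2 * scalar_prod u u + 2 * scalar_prod v v"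
    using u v comm_scalar_prod[OF u v]
    by (simp add: add_scalar_prod_distrib[of _ n] scalar_prod_add_distrib[of _ n] minus_scalar_prod_distrib[of _ n] scalar_prod_minus_distrib[of _ n])
  have "4 * scalar_prod u w \<le> c * scalar_prod (u + v) (u + v) + c * scalar_prod (u - v) (u - v)"
    using bound[of "u + v"] bound[of "u - v"] u v unfolding plus minus by (simp add: abs_le_iff)
  also have "\<dots> = 2 * c * (scalar_prod u u + scalar_prod v v)"
    unfolding distrib_left[symmetric] norms by simp
  finally have "4 * scalar_prod u w \<le> 2 * c * (scalar_prod u u + scalar_prod v v)" .
  moreover have "scalar_prod u w = scalar_prod w w / c" "scalar_prod u u = scalar_prod w w / c\<^sup>2"
    using w by (simp_all add: u_def power2_eq_square)
  ultimately have "4 * (scalar_prod w w / c) \<le> 2 * c * (scalar_prod w w / c\<^sup>2 + scalar_prod v v)"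
    by simp
  then have "scalar_prod w w \<le> c * c * scalar_prod v v"
    using c by (simp add: field_simps power2_eq_square)
  then show ?thesis by (simp add: w_def power2_eq_square)
qed

lemma spectral_norm_bounds:
  assumes A: "A \<in> carrier_mat n n" and c: "0 \<le> c"
    and bound: "\<And>v. v \<in> carrier_vec n \<Longrightarrow> scalar_prod (A *\<^sub>v v) (A *\<^sub>v v) \<le> c\<^sup>2 * scalar_prod v v"
  shows "0 \<le> spectral_norm A" and "spectral_norm A \<le> c"
proof -
  define r where "r v = euclidean_norm (A *\<^sub>v v) / euclidean_norm v" for v
  have r: "r v \<le> c" if "v \<in> carrier_vec n" for v
  proof -
    have "euclidean_norm (A *\<^sub>v v) \<le> c * euclidean_norm v"
      unfolding euclidean_norm_def using real_sqrt_le_mono[OF bound[OF that]] c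
      by (simp add: real_sqrt_mult)
    moreover have "0 \<le> euclidean_norm v"
      by (simp add: euclidean_norm_def scalar_prod_self_nonneg)
    ultimately show ?thesis
      unfolding r_def using c by (simp add: divide_le_eq)
  qed
  have sn: "spectral_norm A = (SUP v \<in> carrier_vec n. r v)"
    using A by (simp add: spectral_norm_def r_def)
  show "spectral_norm A \<le> c"
    unfolding sn using r zero_carrier_vec[of n] by (intro cSUP_least) blast+
  have "r (0\<^sub>v n) \<le> (SUP v \<in> carrier_vec n. r v)"
    using r by (intro cSUP_upper bdd_aboveI2) auto
  moreover have "r (0\<^sub>v n) = 0"
    using A by (simp add: r_def euclidean_norm_def)
  ultimately show "0 \<le> spectral_norm A" by (simp add: sn)
qed

text \<open>
  The matrix \<open>X\<close> is \<open>(1 + B)\<^sup>-\<^sup>1 (E + B)\<close>, written without an inverse. Both norm bounds come from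
  solving for the deviation from the identity and testing the resulting equation against the
  deviation itself, where accretivity discards the contribution of \<open>B\<close>. For \<open>y = X v - v\<close> the equation is
  \<open>(1 + B) y = (E - 1) v\<close>, which gives \<open>\<parallel>y\<parallel> \<le> \<parallel>(E - 1) v\<parallel> \<le> \<parallel>v\<parallel> / 2\<close>; if \<open>X w = v\<close>, then
  \<open>z = w - v\<close> satisfies \<open>(E + B) z = (1 - E) v\<close>, which gives \<open>\<parallel>z\<parallel> \<le> 2 \<parallel>(E - 1) v\<parallel> \<le> \<parallel>v\<parallel>\<close>.
  The second estimate also shows that \<open>X\<close> is injective.
\<close>

lemma near_identity_condition:
  fixes E B X :: "real mat"
  assumes E: "E \<in> carrier_mat n n" "transpose_mat E = E"
    and B: "B \<in> carrier_mat n n" and X: "X \<in> carrier_mat n n"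
    and lower: "\<And>v. v \<in> carrier_vec n \<Longrightarrow> scalar_prod v v / 2 \<le> scalar_prod v (E *\<^sub>v v)"
    and upper: "\<And>v. v \<in> carrier_vec n \<Longrightarrow> scalar_prod v (E *\<^sub>v v) \<le> 3 / 2 * scalar_prod v v"
    and accretive: "\<And>v. v \<in> carrier_vec n \<Longrightarrow> 0 \<le> scalar_prod v (B *\<^sub>v v)"
    and eq: "(1\<^sub>m n + B) * X = E + B"
  shows "invertible_mat X" and "condition_number X \<le> 3"
proof -
  have one_minus: "(E - 1\<^sub>m n) *\<^sub>v v = E *\<^sub>v v - v" if "v \<in> carrier_vec n" for v
    using that E by (simp add: minus_mult_distrib_mat_vec[OF E(1) one_carrier_mat])
  have apply_eq: "X *\<^sub>v v + B *\<^sub>v (X *\<^sub>v v) = E *\<^sub>v v + B *\<^sub>v v" if v: "v \<in> carrier_vec n" for v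
  proof -
    have "X *\<^sub>v v + B *\<^sub>v (X *\<^sub>v v) = (1\<^sub>m n + B) *\<^sub>v (X *\<^sub>v v)"
      using X B v by (subst add_mult_distrib_mat_vec[of _ n n]) auto
    also have "\<dots> = ((1\<^sub>m n + B) * X) *\<^sub>v v"
      using X B v by (subst assoc_mult_mat_vec[of _ n n]) auto
    also have "\<dots> = E *\<^sub>v v + B *\<^sub>v v"
      unfolding eq using E B v by (subst add_mult_distrib_mat_vec[of _ n n]) auto
    finally show ?thesis .
  qed
  have defect: "scalar_prod (E *\<^sub>v v - v) (E *\<^sub>v v - v) \<le> 1 / 4 * scalar_prod v v" if v: "v \<in> carrier_vec n" for v
  proof -
    have "scalar_prod ((E - 1\<^sub>m n) *\<^sub>v v) ((E - 1\<^sub>m n) *\<^sub>v v) \<le> (1 / 2)\<^sup>2 * scalar_prod v v"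
    proof (rule symmetric_form_bound_imp_norm_bound[OF _ _ _ _ v])
      show "E - 1\<^sub>m n \<in> carrier_mat n n" by (intro minus_carrier_mat) simp
      show "transpose_mat (E - 1\<^sub>m n) = E - 1\<^sub>m n"
        using E by (subst transpose_minus[of _ n n]) auto
    next
      fix u :: "real Matrix.vec" assume u: "u \<in> carrier_vec n"
      have "scalar_prod u ((E - 1\<^sub>m n) *\<^sub>v u) = scalar_prod u (E *\<^sub>v u) - scalar_prod u u"
        using E u by (simp add: one_minus scalar_prod_minus_distrib[of _ n])
      then show "\<bar>scalar_prod u ((E - 1\<^sub>m n) *\<^sub>v u)\<bar> \<le> 1 / 2 * scalar_prod u u"
        using lower[OF u] upper[OF u] by linarith
    qed simp
    then show ?thesis using v by (simp add: one_minus power2_eq_square)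
  qed
  have X_bound: "scalar_prod (X *\<^sub>v v) (X *\<^sub>v v) \<le> (3 / 2)\<^sup>2 * scalar_prod v v" if v: "v \<in> carrier_vec n" for v
  proof -
    define y d where "y = X *\<^sub>v v - v" and "d = E *\<^sub>v v - v"
    have y: "y \<in> carrier_vec n" and d: "d \<in> carrier_vec n" and By: "B *\<^sub>v y \<in> carrier_vec n"
      using X E B v by (simp_all add: y_def d_def)
    have Xv: "X *\<^sub>v v = v + y" using X v by (auto simp: y_def)
    have Ev: "E *\<^sub>v v = v + d" using E v by (auto simp: d_def)
    have "v + y + (B *\<^sub>v v + B *\<^sub>v y) = v + d + B *\<^sub>v v"
      using apply_eq[OF v] unfolding Xv Ev using v y by (simp add: mult_add_distrib_mat_vec[OF B])
    then have yB: "y + B *\<^sub>v y = d"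
      using v y d By B by (auto simp: vec_eq_iff)
    have "scalar_prod y y \<le> scalar_prod y y + scalar_prod y (B *\<^sub>v y)"
      using accretive[OF y] by simp
    also have "\<dots> = scalar_prod y d"
      using y By by (simp add: scalar_prod_add_distrib[of _ n] flip: yB)
    finally have "scalar_prod y y \<le> scalar_prod y d" .
    moreover have "0 \<le> scalar_prod (y - d) (y - d)" by (rule scalar_prod_self_nonneg)
    moreover have "scalar_prod (y - d) (y - d) = scalar_prod y y - 2 * scalar_prod y d + scalar_prod d d"
      using y d comm_scalar_prod[OF y d] by (simp add: minus_scalar_prod_distrib[of _ n] scalar_prod_minus_distrib[of _ n])
    ultimately have yd: "scalar_prod y y \<le> scalar_prod d d" by linarith
    \<comment> \<open>The square of \<open>v - 2 y\<close> bounds the cross term in the square of \<open>v + y\<close>: this is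
      \<open>2 (v \<bullet> y) \<le> (v \<bullet> v) / 2 + 2 (y \<bullet> y)\<close>.\<close>
    have "scalar_prod (v - 2 \<cdot>\<^sub>v y) (v - 2 \<cdot>\<^sub>v y) = scalar_prod v v - 4 * scalar_prod v y + 4 * scalar_prod y y"
      using y v comm_scalar_prod[OF y v] by (simp add: minus_scalar_prod_distrib[of _ n] scalar_prod_minus_distrib[of _ n])
    moreover have "0 \<le> scalar_prod (v - 2 \<cdot>\<^sub>v y) (v - 2 \<cdot>\<^sub>v y)" by (rule scalar_prod_self_nonneg)
    moreover have "scalar_prod (v + y) (v + y) = scalar_prod v v + 2 * scalar_prod v y + scalar_prod y y"
      using y v comm_scalar_prod[OF y v] by (simp add: add_scalar_prod_distrib[of _ n] scalar_prod_add_distrib[of _ n])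
    moreover have "scalar_prod d d \<le> 1 / 4 * scalar_prod v v" using defect[OF v] by (simp add: d_def)
    ultimately show ?thesis using yd unfolding Xv by (simp add: power2_eq_square)
  qed
  have inverse_bound: "scalar_prod w w \<le> 4 * scalar_prod v v" if v: "v \<in> carrier_vec n" and w: "w \<in> carrier_vec n" and Xw: "X *\<^sub>v w = v" for v w
  proof -
    define z d where "z = w - v" and "d = E *\<^sub>v v - v"
    have z: "z \<in> carrier_vec n" and d: "d \<in> carrier_vec n" and Bz: "B *\<^sub>v z \<in> carrier_vec n" and Ez: "E *\<^sub>v z \<in> carrier_vec n"
      using w E B v by (simp_all add: z_def d_def)
    have wz: "w = v + z" using w v by (auto simp: z_def)
    have Ev: "E *\<^sub>v v = v + d" using E v by (auto simp: d_def)
    have "v + B *\<^sub>v v = v + d + E *\<^sub>v z + (B *\<^sub>v v + B *\<^sub>v z)"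
      using apply_eq[OF w, unfolded Xw] unfolding wz using v z by (simp add: mult_add_distrib_mat_vec[OF B] mult_add_distrib_mat_vec[OF E(1)] Ev)
    then have zB: "E *\<^sub>v z + B *\<^sub>v z = - d"
      using v z d Bz Ez B by (auto simp: vec_eq_iff)
    have "scalar_prod z z / 2 \<le> scalar_prod z (E *\<^sub>v z) + scalar_prod z (B *\<^sub>v z)"
      using accretive[OF z] lower[OF z] by simp
    also have "\<dots> = - scalar_prod z d"
      using z Bz Ez d zB by (simp add: scalar_prod_add_distrib[of _ n, symmetric])
    finally have "scalar_prod z z / 2 \<le> - scalar_prod z d" .
    \<comment> \<open>Completing the square absorbs \<open>z \<bullet> d\<close> with the weight that makes the bound on \<open>z\<close> sharp.\<close>
    moreover have "0 \<le> scalar_prod (z + 2 \<cdot>\<^sub>v d) (z + 2 \<cdot>\<^sub>v d)" by (rule scalar_prod_self_nonneg)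
    moreover have "scalar_prod (z + 2 \<cdot>\<^sub>v d) (z + 2 \<cdot>\<^sub>v d) = scalar_prod z z + 4 * scalar_prod z d + 4 * scalar_prod d d"
      using z d comm_scalar_prod[OF z d] by (simp add: add_scalar_prod_distrib[of _ n] scalar_prod_add_distrib[of _ n])
    moreover have "scalar_prod d d \<le> 1 / 4 * scalar_prod v v" using defect[OF v] by (simp add: d_def)
    ultimately have zv: "scalar_prod z z \<le> scalar_prod v v" by linarith
    have "scalar_prod (v - z) (v - z) = scalar_prod v v - 2 * scalar_prod v z + scalar_prod z z"
      using z v comm_scalar_prod[OF z v] by (simp add: minus_scalar_prod_distrib[of _ n] scalar_prod_minus_distrib[of _ n])
    moreover have "0 \<le> scalar_prod (v - z) (v - z)" by (rule scalar_prod_self_nonneg)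
    moreover have "scalar_prod (v + z) (v + z) = scalar_prod v v + 2 * scalar_prod v z + scalar_prod z z"
      using z v comm_scalar_prod[OF z v] by (simp add: add_scalar_prod_distrib[of _ n] scalar_prod_add_distrib[of _ n])
    ultimately show ?thesis using zv unfolding wz by simp
  qed
  have det: "det X \<noteq> 0"
  proof (rule det_nonzero_if_injective[OF X])
    fix w assume w: "w \<in> carrier_vec n" "X *\<^sub>v w = 0\<^sub>v n"
    have "scalar_prod w w \<le> 0"
      using inverse_bound[of "0\<^sub>v n" w] w by simp
    then show "w = 0\<^sub>v n"
      using scalar_prod_self_nonneg[of w] scalar_prod_self_eq_0[OF w(1)] by simp
  qed
  note inv = matrix_inverse_det[OF X det]
  show "invertible_mat X" by (rule invertible_mat_if_det_nonzero[OF X det])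
  have "scalar_prod (matrix_inverse X *\<^sub>v v) (matrix_inverse X *\<^sub>v v) \<le> 2\<^sup>2 * scalar_prod v v" if v: "v \<in> carrier_vec n" for v
  proof -
    have "X *\<^sub>v (matrix_inverse X *\<^sub>v v) = v"
      using inv X v by (simp flip: assoc_mult_mat_vec)
    then show ?thesis using inverse_bound[OF v, of "matrix_inverse X *\<^sub>v v"] inv v by simp
  qed
  then have "spectral_norm (matrix_inverse X) \<le> 2"
    using inv by (intro spectral_norm_bounds(2)) auto
  moreover have "0 \<le> spectral_norm X" "spectral_norm X \<le> 3 / 2"
    using spectral_norm_bounds[OF X _ X_bound] by simp_all
  ultimately have "condition_number X \<le> 2 * (3 / 2)"
    unfolding condition_number_def by (intro mult_mono) auto
  then show "condition_number X \<le> 3" by simp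
qed

section \<open>Square roots of positive definite matrices\<close>

text \<open>
  Over the complex numbers there is an eigenvector \<open>x + i y\<close>, for an eigenvalue \<open>a + i b\<close>.
  Separating real and imaginary parts and using symmetry gives \<open>b (x \<bullet> x + y \<bullet> y) = 0\<close>, so
  \<open>b = 0\<close> and whichever of \<open>x\<close> and \<open>y\<close> is nonzero is a real eigenvector.
\<close>

lemma symmetric_real_eigenvector:
  fixes A :: "real mat"
  assumes A: "A \<in> carrier_mat n n" "transpose_mat A = A" and n: "0 < n"
  shows "\<exists>e v. v \<in> carrier_vec n \<and> v \<noteq> 0\<^sub>v n \<and> A *\<^sub>v v = e \<cdot>\<^sub>v v"
proof -
  define C where "C = map_mat complex_of_real A"
  have C: "C \<in> carrier_mat n n" using A by (simp add: C_def)
  then obtain l z where "eigenvector C z l"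
    using spectrum_non_empty[OF C n] by (auto simp: spectrum_def eigenvalue_def)
  then have z: "z \<in> carrier_vec n" "z \<noteq> 0\<^sub>v n" "C *\<^sub>v z = l \<cdot>\<^sub>v z"
    using C by (auto simp: eigenvector_def)
  define x y where "x = map_vec Re z" and "y = map_vec Im z"
  have xy: "x \<in> carrier_vec n" "y \<in> carrier_vec n" using z by (simp_all add: x_def y_def)
  have comp: "(\<Sum>j<n. complex_of_real (A $$ (i, j)) * z $ j) = l * z $ i" if "i < n" for i
    using arg_cong[OF z(3), of "\<lambda>u. u $ i"] that z(1) A
    by (simp add: C_def scalar_prod_def atLeast0LessThan)
  have Ax: "A *\<^sub>v x = Re l \<cdot>\<^sub>v x - Im l \<cdot>\<^sub>v y"
    using arg_cong[OF comp, of _ Re] A z(1)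
    by (auto simp: scalar_prod_def atLeast0LessThan x_def y_def)
  have Ay: "A *\<^sub>v y = Re l \<cdot>\<^sub>v y + Im l \<cdot>\<^sub>v x"
    using arg_cong[OF comp, of _ Im] A z(1)
    by (auto simp: scalar_prod_def atLeast0LessThan x_def y_def)
  have "scalar_prod y (A *\<^sub>v x) = scalar_prod x (A *\<^sub>v y)"
    by (rule symmetric_swap[OF A xy(2,1)])
  then have "Im l * (scalar_prod x x + scalar_prod y y) = 0"
    unfolding Ax Ay using xy comm_scalar_prod[OF xy]
    by (simp add: scalar_prod_minus_distrib[of _ n] scalar_prod_add_distrib[of _ n] algebra_simps)
  moreover have "x \<noteq> 0\<^sub>v n \<or> y \<noteq> 0\<^sub>v n"
    using z(1,2) by (auto simp: x_def y_def vec_eq_iff complex_eq_iff)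
  moreover have "scalar_prod x x + scalar_prod y y \<noteq> 0" if "x \<noteq> 0\<^sub>v n \<or> y \<noteq> 0\<^sub>v n"
    using that scalar_prod_self_nonneg[of x] scalar_prod_self_nonneg[of y]
      scalar_prod_self_eq_0[OF xy(1)] scalar_prod_self_eq_0[OF xy(2)] by linarith
  ultimately have "Im l = 0" by auto
  then have "A *\<^sub>v x = Re l \<cdot>\<^sub>v x" "A *\<^sub>v y = Re l \<cdot>\<^sub>v y"
    unfolding Ax Ay using xy by (auto simp: vec_eq_iff)
  then show ?thesis
    using xy \<open>x \<noteq> 0\<^sub>v n \<or> y \<noteq> 0\<^sub>v n\<close> by blast
qed

lemma symmetric_unit_eigenvector:
  fixes A :: "real mat"
  assumes A: "A \<in> carrier_mat n n" "transpose_mat A = A" and n: "0 < n"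
  shows "\<exists>e v. v \<in> carrier_vec n \<and> scalar_prod v v = 1 \<and> A *\<^sub>v v = e \<cdot>\<^sub>v v"
proof -
  obtain e v where v: "v \<in> carrier_vec n" "v \<noteq> 0\<^sub>v n" "A *\<^sub>v v = e \<cdot>\<^sub>v v"
    using symmetric_real_eigenvector[OF assms] by blast
  define r where "r = sqrt (scalar_prod v v)"
  have pos: "0 < scalar_prod v v"
    using scalar_prod_self_nonneg[of v] scalar_prod_self_eq_0[OF v(1)] v(2) by linarith
  then have r: "r * r = scalar_prod v v" "r \<noteq> 0" by (simp_all add: r_def)
  define w where "w = (1 / r) \<cdot>\<^sub>v v"
  have "w \<in> carrier_vec n" using v by (simp add: w_def)
  moreover have "scalar_prod w w = 1"
    using v r pos by (simp add: w_def field_simps)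
  moreover have "A *\<^sub>v w = e \<cdot>\<^sub>v w"
    using v A by (simp add: w_def mult_mat_vec smult_smult_assoc mult.commute)
  ultimately show ?thesis by blast
qed

text \<open>
  The reflection in the hyperplane orthogonal to \<open>u = v - e\<^sub>0\<close> exchanges the unit vectors \<open>e\<^sub>0\<close> and
  \<open>v\<close>. It is its own inverse and its own transpose, so conjugation by it is at once a similarity
  and a congruence.
\<close>

lemma householder:
  fixes v :: "real Matrix.vec"
  assumes v: "v \<in> carrier_vec n" "scalar_prod v v = 1" and n: "0 < n"
  shows "\<exists>W. W \<in> carrier_mat n n \<and> transpose_mat W = W \<and> W * W = 1\<^sub>m n \<and> W *\<^sub>v unit_vec n 0 = v"
proof (cases "v = unit_vec n 0")
  case True
  then show ?thesis by (intro exI[of _ "1\<^sub>m n"]) simp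
next
  case False
  define u where "u i = v $ i - (if i = 0 then 1 else 0)" for i
  define s where "s = (\<Sum>i<n. (u i)\<^sup>2)"
  define c where "c = 2 / s"
  define W where "W = Matrix.mat n n (\<lambda>(i, j). (if i = j then 1 else 0) - c * u i * u j)"
  have W: "W \<in> carrier_mat n n" by (simp add: W_def)
  have "s = (\<Sum>i<n. (v $ i)\<^sup>2 + (if i = 0 then 1 - 2 * v $ 0 else 0))"
    unfolding s_def by (intro sum.cong) (auto simp: u_def power2_eq_square algebra_simps)
  also have "\<dots> = 2 - 2 * v $ 0"
    using v n by (simp add: sum.distrib scalar_prod_self)
  finally have s: "s = 2 - 2 * v $ 0" .
  have "s \<noteq> 0"
  proof
    assume "s = 0"
    then have "\<forall>i<n. u i = 0" by (simp add: s_def sum_nonneg_eq_0_iff)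
    then have "v = unit_vec n 0" using v(1) by (auto simp: u_def vec_eq_iff)
    then show False using False by simp
  qed
  then have cs: "c * s = 2" by (simp add: c_def)
  have "transpose_mat W = W" by (auto simp: W_def)
  moreover have "W * W = 1\<^sub>m n"
  proof (rule eq_matI)
    fix i j assume ij: "i < dim_row (1\<^sub>m n)" "j < dim_col (1\<^sub>m n)"
    have "(W * W) $$ (i, j) = (\<Sum>k<n. ((if i = k then 1 else 0) - c * u i * u k) * ((if k = j then 1 else 0) - c * u k * u j))"
      using ij by (simp add: W_def scalar_prod_def atLeast0LessThan)
    also have "\<dots> = (\<Sum>k<n. (if i = k then (if i = j then 1 else 0) - c * u i * u j else 0)
        + (if k = j then - (c * u i * u j) else 0) + c * c * u i * u j * (u k)\<^sup>2)"
      by (intro sum.cong) (auto simp: power2_eq_square algebra_simps)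
    also have "\<dots> = (if i = j then 1 else 0) - 2 * (c * u i * u j) + c * c * u i * u j * s"
      using ij by (simp add: sum.distrib s_def sum_distrib_left)
    also have "c * c * u i * u j * s = (c * s) * (c * u i * u j)"
      by (simp only: mult_ac)
    finally show "(W * W) $$ (i, j) = 1\<^sub>m n $$ (i, j)" unfolding cs using ij by simp
  qed (use W in auto)
  moreover have "W *\<^sub>v unit_vec n 0 = v"
  proof (rule eq_vecI)
    fix i assume "i < dim_vec v"
    then have i: "i < n" using v by simp
    have "(W *\<^sub>v unit_vec n 0) $ i = (if i = 0 then 1 else 0) - c * u i * u 0"
      using i n by (simp add: W_def)
    also have "c * u i * u 0 = - u i"
    proof -
      have s0: "s = - 2 * u 0" by (simp add: u_def s)
      have "c * u i * u 0 = - ((c * s) * u i) / 2" unfolding s0 by simp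
      then show ?thesis unfolding cs by simp
    qed
    finally show "(W *\<^sub>v unit_vec n 0) $ i = v $ i" by (simp add: u_def)
  qed (use v W in auto)
  ultimately show ?thesis using W by blast
qed

text \<open>
  The block diagonal matrix with blocks \<open>c\<close> and \<open>A\<close>, indexed so that sums over \<open>{..<Suc n}\<close> split off
  the first block.
\<close>

definition bordered :: "nat \<Rightarrow> real \<Rightarrow> real mat \<Rightarrow> real mat" where
  "bordered n c A = Matrix.mat (Suc n) (Suc n)
     (\<lambda>(i, j). case (i, j) of (0, 0) \<Rightarrow> c | (Suc i', Suc j') \<Rightarrow> A $$ (i', j') | _ \<Rightarrow> 0)"

lemma bordered_carrier [simp]: "bordered n c A \<in> carrier_mat (Suc n) (Suc n)"
  by (simp add: bordered_def)

lemma dim_bordered [simp]: "dim_row (bordered n c A) = Suc n" "dim_col (bordered n c A) = Suc n"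
  by (simp_all add: bordered_def)

lemma bordered_mult:
  assumes "A \<in> carrier_mat n n" "B \<in> carrier_mat n n"
  shows "bordered n c A * bordered n d B = bordered n (c * d) (A * B)"
proof (rule eq_matI)
  fix i j assume ij: "i < dim_row (bordered n (c * d) (A * B))" "j < dim_col (bordered n (c * d) (A * B))"
  show "(bordered n c A * bordered n d B) $$ (i, j) = bordered n (c * d) (A * B) $$ (i, j)"
    using ij assms
    by (cases i; cases j) (simp_all add: bordered_def scalar_prod_def atLeast0LessThan sum.lessThan_Suc_shift del: sum.lessThan_Suc)
qed (simp_all add: bordered_def)

lemma bordered_form:
  assumes "A \<in> carrier_mat n n" "v \<in> carrier_vec (Suc n)"
  shows "scalar_prod v (bordered n c A *\<^sub>v v)
     = c * (v $ 0)\<^sup>2 + scalar_prod (Matrix.vec n (\<lambda>i. v $ Suc i)) (A *\<^sub>v Matrix.vec n (\<lambda>i. v $ Suc i))"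
  unfolding quadratic_form_eq_sum[OF bordered_carrier assms(2)]
    quadratic_form_eq_sum[OF assms(1) vec_carrier]
  by (simp add: bordered_def sum.lessThan_Suc_shift power2_eq_square del: sum.lessThan_Suc)

lemma bordered_sym_pos_def_iff:
  assumes A: "A \<in> carrier_mat n n"
  shows "sym_pos_def (bordered n c A) \<longleftrightarrow> 0 < c \<and> sym_pos_def A"
proof
  assume spd: "sym_pos_def (bordered n c A)"
  then have pos: "0 < scalar_prod v (bordered n c A *\<^sub>v v)" if "v \<in> carrier_vec (Suc n)" "v \<noteq> 0\<^sub>v (Suc n)" for v
    using that bordered_carrier[of n c A] unfolding sym_pos_def_def by auto
  have "0 < c"
  proof -
    have "Matrix.vec n (\<lambda>i. unit_vec (Suc n) 0 $ Suc i) = (0\<^sub>v n :: real Matrix.vec)"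
      by (intro eq_vecI) auto
    then show ?thesis
      using pos[of "unit_vec (Suc n) 0"] A bordered_form[OF A, of "unit_vec (Suc n) 0" c] by simp
  qed
  moreover have "transpose_mat A = A"
  proof (rule eq_matI)
    fix i j assume "i < dim_row A" "j < dim_col A"
    moreover have "transpose_mat (bordered n c A) $$ (Suc i, Suc j) = bordered n c A $$ (Suc i, Suc j)"
      using spd by (simp add: sym_pos_def_def)
    ultimately show "transpose_mat A $$ (i, j) = A $$ (i, j)"
      using A by (simp add: bordered_def)
  qed (use A in auto)
  moreover have "0 < scalar_prod v (A *\<^sub>v v)" if v: "v \<in> carrier_vec n" "v \<noteq> 0\<^sub>v n" for v
  proof -
    define w where "w = Matrix.vec (Suc n) (\<lambda>i. case i of 0 \<Rightarrow> 0 | Suc k \<Rightarrow> v $ k)"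
    have w: "w \<in> carrier_vec (Suc n)" "Matrix.vec n (\<lambda>i. w $ Suc i) = v" "w $ 0 = 0"
      using v by (auto simp: w_def)
    then have "w \<noteq> 0\<^sub>v (Suc n)" using v by (auto simp: vec_eq_iff)
    then show ?thesis
      using pos[OF w(1)] bordered_form[OF A w(1), of c] w by simp
  qed
  ultimately show "0 < c \<and> sym_pos_def A"
    using A unfolding sym_pos_def_def by auto
next
  assume *: "0 < c \<and> sym_pos_def A"
  have "transpose_mat (bordered n c A) = bordered n c A"
  proof (rule eq_matI)
    fix i j assume ij: "i < dim_row (bordered n c A)" "j < dim_col (bordered n c A)"
    have sym: "A $$ (a, b) = A $$ (b, a)" if "a < n" "b < n" for a b
      using symmetric_index[OF A _ that] * by (simp add: sym_pos_def_def)
    show "transpose_mat (bordered n c A) $$ (i, j) = bordered n c A $$ (i, j)"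
      using ij sym by (cases i; cases j) (simp_all add: bordered_def)
  qed (simp_all add: bordered_def)
  moreover have "0 < scalar_prod v (bordered n c A *\<^sub>v v)" if v: "v \<in> carrier_vec (Suc n)" "v \<noteq> 0\<^sub>v (Suc n)" for v :: "real Matrix.vec"
  proof -
    define t where "t = Matrix.vec n (\<lambda>i. v $ Suc i)"
    have t: "t \<in> carrier_vec n" by (simp add: t_def)
    have tA: "0 \<le> scalar_prod t (A *\<^sub>v t)" "t \<noteq> 0\<^sub>v n \<Longrightarrow> 0 < scalar_prod t (A *\<^sub>v t)"
      using * t A unfolding sym_pos_def_def by (cases "t = 0\<^sub>v n"; auto simp: less_imp_le)+
    have "v $ 0 \<noteq> 0 \<or> t \<noteq> 0\<^sub>v n"
    proof (rule ccontr)
      assume "\<not> ?thesis"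
      then have "v $ i = 0" if "i < Suc n" for i
        using that by (cases i) (auto simp: t_def vec_eq_iff)
      then show False using v by (auto simp: vec_eq_iff)
    qed
    then show ?thesis
      unfolding bordered_form[OF A v(1)] t_def[symmetric] using tA *
      by (auto intro: add_pos_nonneg add_nonneg_pos)
  qed
  ultimately show "sym_pos_def (bordered n c A)"
    using bordered_carrier[of n c A] unfolding sym_pos_def_def by auto
qed

text \<open>
  Induction on the order. A reflection that takes \<open>e\<^sub>0\<close> to a unit eigenvector turns the matrix into a
  block diagonal one with blocks \<open>e > 0\<close> and a smaller positive definite matrix. A root of the
  block diagonal matrix is assembled blockwise and reflected back.
\<close>

lemma sym_pos_def_has_sqrt:
  assumes "A \<in> carrier_mat n n" "sym_pos_def A"
  shows "\<exists>S. S \<in> carrier_mat n n \<and> sym_pos_def S \<and> S * S = A"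
  using assms
proof (induction n arbitrary: A)
  case 0
  then show ?case by (intro exI[of _ A]) auto
next
  case (Suc n)
  have A: "A \<in> carrier_mat (Suc n) (Suc n)" "transpose_mat A = A"
    using Suc.prems by (simp_all add: sym_pos_def_def)
  obtain e v where v: "v \<in> carrier_vec (Suc n)" "scalar_prod v v = 1" "A *\<^sub>v v = e \<cdot>\<^sub>v v"
    using symmetric_unit_eigenvector[OF A] by auto
  obtain W where W: "W \<in> carrier_mat (Suc n) (Suc n)" "transpose_mat W = W" "W * W = 1\<^sub>m (Suc n)"
    and We: "W *\<^sub>v unit_vec (Suc n) 0 = v"
    using householder[OF v(1,2)] by auto
  have cancel: "W * (W * B) = B" if "B \<in> carrier_mat (Suc n) (Suc n)" for B
    using W that by (simp flip: assoc_mult_mat[of _ "Suc n" "Suc n" _ "Suc n" _ "Suc n"])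
  define A' where "A' = W * A * W"
  have A': "A' \<in> carrier_mat (Suc n) (Suc n)" "transpose_mat A' = A'"
    using congruence_symmetric[OF W(1,2) A] W A by (simp_all add: A'_def)
  have Wv: "W *\<^sub>v v = unit_vec (Suc n) 0"
    unfolding We[symmetric] using W by (simp flip: assoc_mult_mat_vec[of _ "Suc n" "Suc n" _ "Suc n"])
  have "A' *\<^sub>v unit_vec (Suc n) 0 = W *\<^sub>v (A *\<^sub>v (W *\<^sub>v unit_vec (Suc n) 0))"
    unfolding A'_def using W A by (simp add: assoc_mult_mat_vec[of _ "Suc n" "Suc n" _ "Suc n"])
  also have "\<dots> = e \<cdot>\<^sub>v unit_vec (Suc n) 0"
    unfolding We v(3) using W v by (simp add: mult_mat_vec Wv)
  finally have col: "A' *\<^sub>v unit_vec (Suc n) 0 = e \<cdot>\<^sub>v unit_vec (Suc n) 0" .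
  have col0: "A' $$ (i, 0) = (if i = 0 then e else 0)" if "i < Suc n" for i
    using arg_cong[OF col, of "\<lambda>u. u $ i"] that A' by simp
  have row0: "A' $$ (0, i) = (if i = 0 then e else 0)" if "i < Suc n" for i
    using symmetric_index[OF A', of 0 i] that col0[of i] by simp
  define B :: "real mat" where "B = Matrix.mat n n (\<lambda>(i, j). A' $$ (Suc i, Suc j))"
  have B: "B \<in> carrier_mat n n" by (simp add: B_def)
  have AB: "A' = bordered n e B"
  proof (rule eq_matI)
    fix i j assume "i < dim_row (bordered n e B)" "j < dim_col (bordered n e B)"
    then show "A' $$ (i, j) = bordered n e B $$ (i, j)"
      using col0[of i] row0[of j] by (cases i; cases j) (simp_all add: bordered_def B_def)
  qed (use A' in \<open>simp_all add: bordered_def\<close>)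
  have "sym_pos_def A'"
    unfolding A'_def using W Suc.prems by (intro sym_pos_def_congruence) auto
  then have e: "0 < e" and spdB: "sym_pos_def B"
    unfolding AB bordered_sym_pos_def_iff[OF B] by auto
  obtain R where R: "R \<in> carrier_mat n n" "sym_pos_def R" "R * R = B"
    using Suc.IH[OF B spdB] by blast
  define S' where "S' = bordered n (sqrt e) R"
  have S': "S' \<in> carrier_mat (Suc n) (Suc n)" "sym_pos_def S'" "S' * S' = A'"
    using R e by (simp_all add: S'_def bordered_sym_pos_def_iff bordered_mult AB)
  define S where "S = W * S' * W"
  have "S \<in> carrier_mat (Suc n) (Suc n)" using W S' by (simp add: S_def)
  moreover have "sym_pos_def S"
    unfolding S_def using W S' by (intro sym_pos_def_congruence) auto
  moreover have "S * S = A"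
  proof -
    note assoc = assoc_mult_mat[of _ "Suc n" "Suc n" _ "Suc n" _ "Suc n"]
    have "S * S = W * (S' * (W * (W * (S' * W))))"
      using W S' by (simp add: S_def assoc)
    also have "\<dots> = W * ((S' * S') * W)"
      using W S'(1) by (simp add: cancel assoc)
    also have "\<dots> = W * (W * (A * (W * W)))"
      unfolding S'(3) A'_def using W(1) A by (simp add: assoc)
    also have "\<dots> = A"
      using W A by (simp add: cancel)
    finally show ?thesis .
  qed
  ultimately show ?case by blast
qed

text \<open>
  Since \<^const>\<open>spd_sqrt\<close> is an arbitrary choice among the positive definite roots, existence of one root
  yields these properties of the chosen one.
\<close>

lemma spd_sqrt_properties:
  assumes "A \<in> carrier_mat n n" "sym_pos_def A"
  shows "spd_sqrt A \<in> carrier_mat n n" "sym_pos_def (spd_sqrt A)" "spd_sqrt A * spd_sqrt A = A"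
proof -
  have S: "sym_pos_def (spd_sqrt A) \<and> spd_sqrt A * spd_sqrt A = A"
    unfolding spd_sqrt_def using sym_pos_def_has_sqrt[OF assms] by (rule someI_ex[OF ex_forward]) blast
  then show "sym_pos_def (spd_sqrt A)" "spd_sqrt A * spd_sqrt A = A" by auto
  then have "dim_row (spd_sqrt A) = n" "dim_col (spd_sqrt A) = n"
    using assms(1) index_mult_mat(2,3)[of "spd_sqrt A" "spd_sqrt A"] by auto
  then show "spd_sqrt A \<in> carrier_mat n n" by auto
qed

section \<open>Kronecker products\<close>

text \<open>
  Row and column indices of a Kronecker product are \<open>p * m + q\<close> with \<open>q < m\<close>.
\<close>

lemma sum_div_mod:
  fixes f :: "nat \<Rightarrow> 'a :: comm_monoid_add"
  shows "(\<Sum>k<n * m. f k) = (\<Sum>p<n. \<Sum>q<m. f (p * m + q))"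
proof -
  have "(\<Sum>k<n * m. f k) = (\<Sum>p<n. \<Sum>k\<in>{p * m..<p * m + m}. f k)"
    by (rule sum.nat_group[symmetric])
  also have "\<dots> = (\<Sum>p<n. \<Sum>q<m. f (p * m + q))"
  proof (rule sum.cong[OF refl])
    fix p
    show "(\<Sum>k\<in>{p * m..<p * m + m}. f k) = (\<Sum>q<m. f (p * m + q))"
      by (rule sum.reindex_bij_witness[of _ "\<lambda>q. p * m + q" "\<lambda>k. k - p * m"]) auto
  qed
  finally show ?thesis .
qed

lemma pair_index_less:
  fixes p q n m :: nat
  assumes "p < n" "q < m"
  shows "p * m + q < n * m"
proof -
  have "p * m + q < Suc p * m" using assms(2) by simp
  also have "\<dots> \<le> n * m" using assms(1) by (intro mult_right_mono) auto
  finally show ?thesis .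
qed

lemma kronecker_carrier [simp]:
  "A \<in> carrier_mat n n \<Longrightarrow> B \<in> carrier_mat m m \<Longrightarrow> kronecker A B \<in> carrier_mat (n * m) (n * m)"
  by (auto simp: kronecker_def)

lemma kronecker_index:
  assumes "A \<in> carrier_mat n n" "B \<in> carrier_mat m m" "r < n * m" "s < n * m"
  shows "kronecker A B $$ (r, s) = A $$ (r div m, s div m) * B $$ (r mod m, s mod m)"
  using assms by (auto simp: kronecker_def)

lemma kronecker_mult:
  assumes A: "A \<in> carrier_mat n n" and B: "B \<in> carrier_mat m m"
    and C: "C \<in> carrier_mat n n" and D: "D \<in> carrier_mat m m"
  shows "kronecker A B * kronecker C D = kronecker (A * C) (B * D)"
proof (rule eq_matI)
  fix r s assume "r < dim_row (kronecker (A * C) (B * D))" "s < dim_col (kronecker (A * C) (B * D))"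
  then have rs: "r < n * m" "s < n * m"
    using A B C D by (auto simp: kronecker_def)
  then have m: "0 < m" by (cases m) auto
  have div: "r div m < n" "s div m < n" "r mod m < m" "s mod m < m"
    using rs m by (simp_all add: less_mult_imp_div_less)
  have "(kronecker A B * kronecker C D) $$ (r, s) = (\<Sum>k<n * m. kronecker A B $$ (r, k) * kronecker C D $$ (k, s))"
    using rs kronecker_carrier[OF A B] kronecker_carrier[OF C D]
    by (simp add: scalar_prod_def atLeast0LessThan)
  also have "\<dots> = (\<Sum>p<n. \<Sum>q<m. (A $$ (r div m, p) * C $$ (p, s div m)) * (B $$ (r mod m, q) * D $$ (q, s mod m)))"
    unfolding sum_div_mod
    by (intro sum.cong refl) (simp add: kronecker_index[OF A B] kronecker_index[OF C D] rs pair_index_less)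
  also have "\<dots> = (\<Sum>p<n. A $$ (r div m, p) * C $$ (p, s div m)) * (\<Sum>q<m. B $$ (r mod m, q) * D $$ (q, s mod m))"
    by (simp add: sum_product)
  also have "\<dots> = kronecker (A * C) (B * D) $$ (r, s)"
    using A B C D rs div by (simp add: kronecker_index[of _ n _ m] scalar_prod_def atLeast0LessThan)
  finally show "(kronecker A B * kronecker C D) $$ (r, s) = kronecker (A * C) (B * D) $$ (r, s)" .
qed (use assms in \<open>auto simp: kronecker_def\<close>)

lemma kronecker_one: "kronecker (1\<^sub>m n) (1\<^sub>m m) = 1\<^sub>m (n * m)"
proof (rule eq_matI)
  fix r s assume "r < dim_row (1\<^sub>m (n * m))" "s < dim_col (1\<^sub>m (n * m))"
  then have rs: "r < n * m" "s < n * m" by auto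
  then have m: "0 < m" by (cases m) auto
  have "r = s" if "r div m = s div m" "r mod m = s mod m"
    using that by (metis div_mult_mod_eq)
  then show "kronecker (1\<^sub>m n) (1\<^sub>m m) $$ (r, s) = 1\<^sub>m (n * m) $$ (r, s)"
    using rs m by (auto simp: kronecker_index[of _ n _ m] less_mult_imp_div_less)
qed (auto simp: kronecker_def)

lemma kronecker_transpose:
  assumes A: "A \<in> carrier_mat n n" and B: "B \<in> carrier_mat m m"
  shows "transpose_mat (kronecker A B) = kronecker (transpose_mat A) (transpose_mat B)"
proof (rule eq_matI)
  fix r s assume "r < dim_row (kronecker (transpose_mat A) (transpose_mat B))"
    "s < dim_col (kronecker (transpose_mat A) (transpose_mat B))"
  then have rs: "r < n * m" "s < n * m" using A B by (auto simp: kronecker_def)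
  then have "0 < m" by (cases m) auto
  then show "transpose_mat (kronecker A B) $$ (r, s) = kronecker (transpose_mat A) (transpose_mat B) $$ (r, s)"
    using rs A B carrier_matD[OF kronecker_carrier[OF A B]]
    by (simp add: kronecker_index[of _ n _ m] less_mult_imp_div_less)
qed (use assms in \<open>auto simp: kronecker_def\<close>)

text \<open>
  The form splits into one copy of the form of \<open>A\<close> for each residue \<open>q\<close>, evaluated on the entries of
  \<open>v\<close> whose index has that residue; hence inequalities between forms pass to the Kronecker products.
\<close>

lemma kronecker_one_right_form:
  assumes A: "A \<in> carrier_mat n n" and v: "v \<in> carrier_vec (n * m)"
  shows "scalar_prod v (kronecker A (1\<^sub>m m) *\<^sub>v v)
    = (\<Sum>q<m. let u = Matrix.vec n (\<lambda>p. v $ (p * m + q)) in scalar_prod u (A *\<^sub>v u))"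
proof -
  have "scalar_prod v (kronecker A (1\<^sub>m m) *\<^sub>v v)
    = (\<Sum>p<n. \<Sum>q<m. \<Sum>p'<n. \<Sum>q'<m. if q' = q then v $ (p * m + q) * A $$ (p, p') * v $ (p' * m + q) else 0)"
    unfolding quadratic_form_eq_sum[OF kronecker_carrier[OF A one_carrier_mat] v] sum_div_mod
    by (intro sum.cong refl) (auto simp: kronecker_index[OF A one_carrier_mat] pair_index_less)
  also have "\<dots> = (\<Sum>p<n. \<Sum>q<m. \<Sum>p'<n. v $ (p * m + q) * A $$ (p, p') * v $ (p' * m + q))"
    by simp
  also have "\<dots> = (\<Sum>q<m. \<Sum>p<n. \<Sum>p'<n. v $ (p * m + q) * A $$ (p, p') * v $ (p' * m + q))"
    by (rule sum.swap)
  finally show ?thesis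
    by (simp add: quadratic_form_eq_sum[OF A vec_carrier])
qed

text \<open>
  The mirror image: \<open>v\<close> is now cut into consecutive blocks of length \<open>m\<close>.
\<close>

lemma kronecker_one_left_form:
  assumes B: "B \<in> carrier_mat m m" and v: "v \<in> carrier_vec (n * m)"
  shows "scalar_prod v (kronecker (1\<^sub>m n) B *\<^sub>v v)
    = (\<Sum>p<n. let u = Matrix.vec m (\<lambda>q. v $ (p * m + q)) in scalar_prod u (B *\<^sub>v u))"
proof -
  have "scalar_prod v (kronecker (1\<^sub>m n) B *\<^sub>v v)
    = (\<Sum>p<n. \<Sum>q<m. \<Sum>p'<n. \<Sum>q'<m. if p' = p then v $ (p * m + q) * B $$ (q, q') * v $ (p * m + q') else 0)"
    unfolding quadratic_form_eq_sum[OF kronecker_carrier[OF one_carrier_mat B] v] sum_div_mod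
    by (intro sum.cong refl) (auto simp: kronecker_index[OF one_carrier_mat B] pair_index_less)
  also have "\<dots> = (\<Sum>p<n. \<Sum>q<m. \<Sum>p'<n. if p' = p then \<Sum>q'<m. v $ (p * m + q) * B $$ (q, q') * v $ (p * m + q') else 0)"
    by (intro sum.cong refl) auto
  also have "\<dots> = (\<Sum>p<n. \<Sum>q<m. \<Sum>q'<m. v $ (p * m + q) * B $$ (q, q') * v $ (p * m + q'))"
    by simp
  finally show ?thesis
    by (simp add: quadratic_form_eq_sum[OF B vec_carrier])
qed

section \<open>Preconditioning a Kronecker sum\<close>

text \<open>
  Everything is conjugated by \<open>W = S\<^sup>-\<^sup>1 \<otimes> I\<close>, which turns the form of \<open>K \<otimes> I\<close> into \<open>v \<bullet> v\<close>. The form of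
  \<open>G \<otimes> I\<close>, which lies between one half and three halves of that of \<open>K \<otimes> I\<close>, becomes the form of \<open>E\<close>,
  and the accretive \<open>I \<otimes> A\<close> becomes the accretive \<open>B\<close>.
\<close>

lemma preconditioned_condition:
  fixes G K A S :: "real mat"
  assumes G: "G \<in> carrier_mat n n" "transpose_mat G = G"
    and S: "S \<in> carrier_mat n n" "sym_pos_def S" "S * S = K"
    and A: "A \<in> carrier_mat m m"
    and lower: "\<And>v. v \<in> carrier_vec n \<Longrightarrow> scalar_prod v (K *\<^sub>v v) / 2 \<le> scalar_prod v (G *\<^sub>v v)"
    and upper: "\<And>v. v \<in> carrier_vec n \<Longrightarrow> scalar_prod v (G *\<^sub>v v) \<le> 3 / 2 * scalar_prod v (K *\<^sub>v v)"
    and accretive: "\<And>v. v \<in> carrier_vec m \<Longrightarrow> 0 \<le> scalar_prod v (A *\<^sub>v v)"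
  defines "Pl \<equiv> kronecker (matrix_inverse S) A + kronecker S (1\<^sub>m m)"
    and "Pr \<equiv> kronecker S (1\<^sub>m m)"
    and "Mt \<equiv> kronecker G (1\<^sub>m m) + kronecker (1\<^sub>m n) A"
  shows "invertible_mat (matrix_inverse Pl * Mt * matrix_inverse Pr)"
    and "condition_number (matrix_inverse Pl * Mt * matrix_inverse Pr) \<le> 3"
proof -
  define d where "d = n * m"
  define R where "R = matrix_inverse S"
  define I where "I = (1\<^sub>m m :: real mat)"
  note inv = matrix_inverse_det[OF S(1) sym_pos_def_det_nonzero[OF S(1,2)], folded R_def]
  have symS: "transpose_mat S = S" using S(2) by (simp add: sym_pos_def_def)
  have symR: "transpose_mat R = R"
    unfolding R_def using S symS sym_pos_def_det_nonzero by (intro matrix_inverse_symmetric) auto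
  have I: "I \<in> carrier_mat m m" by (simp add: I_def)
  have K: "K \<in> carrier_mat n n" using S by auto
  \<comment> \<open>\<open>T\<close> is the common left factor of \<open>Pl\<close> and of \<open>Mt * W\<close>; it cancels in the quotient.\<close>
  define T W where "T = kronecker S I" and "W = kronecker R I"
  have kc: "kronecker X Y \<in> carrier_mat d d" if "X \<in> carrier_mat n n" "Y \<in> carrier_mat m m" for X Y
    using that by (simp add: d_def)
  have T: "T \<in> carrier_mat d d" and W: "W \<in> carrier_mat d d"
    using kc S(1) inv(1) I by (simp_all add: T_def W_def)
  have TW: "T * W = 1\<^sub>m d" and WT: "W * T = 1\<^sub>m d"
    unfolding T_def W_def d_def kronecker_one[symmetric]
    using S(1) inv I by (simp_all add: kronecker_mult[of _ n _ m] I_def)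
  have symW: "transpose_mat W = W"
    unfolding W_def using kronecker_transpose[OF inv(1) I] symR by (simp add: I_def)
  define E B where "E = W * kronecker G I * W" and "B = W * kronecker (1\<^sub>m n) A * W"
  have GI: "kronecker G I \<in> carrier_mat d d" and KI: "kronecker K I \<in> carrier_mat d d"
    and IA: "kronecker (1\<^sub>m n) A \<in> carrier_mat d d" and RA: "kronecker R A \<in> carrier_mat d d"
    using kc G(1) K A inv(1) I by simp_all
  have E: "E \<in> carrier_mat d d" and B: "B \<in> carrier_mat d d"
    using W GI IA by (simp_all add: E_def B_def)
  have "transpose_mat (kronecker G I) = kronecker G I"
    using kronecker_transpose[OF G(1) I] G(2) by (simp add: I_def)
  then have symE: "transpose_mat E = E"
    unfolding E_def by (intro congruence_symmetric[OF W symW GI])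
  have WKW: "W * kronecker K I * W = 1\<^sub>m d"
  proof -
    have "R * K * R = (R * S) * (S * R)"
      unfolding S(3)[symmetric] using S(1) inv(1) by (simp add: assoc_mult_mat[of _ n n _ n _ n])
    then have "R * K * R = 1\<^sub>m n" using inv by simp
    then show ?thesis
      unfolding W_def d_def kronecker_one[symmetric]
      using inv(1) K by (simp add: kronecker_mult[of _ n _ m] I_def)
  qed
  have form_E: "scalar_prod v (E *\<^sub>v v) = scalar_prod (W *\<^sub>v v) (kronecker G I *\<^sub>v (W *\<^sub>v v))"
    and form_B: "scalar_prod v (B *\<^sub>v v) = scalar_prod (W *\<^sub>v v) (kronecker (1\<^sub>m n) A *\<^sub>v (W *\<^sub>v v))"
    and form_1: "scalar_prod v v = scalar_prod (W *\<^sub>v v) (kronecker K I *\<^sub>v (W *\<^sub>v v))"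
    if v: "v \<in> carrier_vec d" for v
    using congruence_form[OF W symW GI v] congruence_form[OF W symW IA v] congruence_form[OF W symW KI v] v
    by (simp_all add: E_def B_def WKW)
  have low: "scalar_prod v v / 2 \<le> scalar_prod v (E *\<^sub>v v)" if v: "v \<in> carrier_vec d" for v
  proof -
    have Wv: "W *\<^sub>v v \<in> carrier_vec (n * m)" using W v by (simp add: d_def)
    show ?thesis
      unfolding form_E[OF v] form_1[OF v] I_def
        kronecker_one_right_form[OF G(1) Wv] kronecker_one_right_form[OF K Wv] sum_divide_distrib
      unfolding Let_def by (intro sum_mono lower) simp
  qed
  have up: "scalar_prod v (E *\<^sub>v v) \<le> 3 / 2 * scalar_prod v v" if v: "v \<in> carrier_vec d" for v
  proof -
    have Wv: "W *\<^sub>v v \<in> carrier_vec (n * m)" using W v by (simp add: d_def)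
    show ?thesis
      unfolding form_E[OF v] form_1[OF v] I_def
        kronecker_one_right_form[OF G(1) Wv] kronecker_one_right_form[OF K Wv] sum_distrib_left
      unfolding Let_def by (intro sum_mono upper) simp
  qed
  have acc: "0 \<le> scalar_prod v (B *\<^sub>v v)" if v: "v \<in> carrier_vec d" for v
  proof -
    have Wv: "W *\<^sub>v v \<in> carrier_vec (n * m)" using W v by (simp add: d_def)
    show ?thesis
      unfolding form_B[OF v] kronecker_one_left_form[OF A Wv] Let_def
      by (intro sum_nonneg accretive) simp
  qed
  have TB: "T * B = kronecker R A"
  proof -
    have "S * (R * 1\<^sub>m n * R) = R"
      using S(1) inv by (simp flip: assoc_mult_mat[of _ n n _ n _ n])
    then show ?thesis
      unfolding T_def B_def W_def using S(1) inv(1) A I by (simp add: kronecker_mult[of _ n _ m] I_def)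
  qed
  have TE: "T * E = kronecker G I * W"
  proof -
    have "T * E = (T * W) * (kronecker G I * W)"
      unfolding E_def using T W GI by (simp add: assoc_mult_mat[of _ d d _ d _ d])
    then show ?thesis using W GI by (simp add: TW)
  qed
  have Pl: "Pl = T * (1\<^sub>m d + B)"
    unfolding Pl_def R_def[symmetric] I_def[symmetric] T_def[symmetric]
    using T B RA by (simp add: mult_add_distrib_mat[of _ d d _ d] TB comm_add_mat[of _ d d])
  have MW: "Mt * W = T * (E + B)"
  proof -
    have "kronecker (1\<^sub>m n) A * W = kronecker R A"
      unfolding W_def using inv(1) A I by (simp add: kronecker_mult[of _ n _ m] I_def)
    then show ?thesis
      unfolding Mt_def I_def[symmetric] using GI IA W T E B
      by (simp add: add_mult_distrib_mat[of _ d d] mult_add_distrib_mat[of _ d d _ d] TE TB)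
  qed
  have PlC: "Pl \<in> carrier_mat d d" unfolding Pl using T B by simp
  have "det Pl \<noteq> 0"
  proof -
    have "det (1\<^sub>m d + B) \<noteq> 0"
    proof (rule det_nonzero_if_injective)
      show "1\<^sub>m d + B \<in> carrier_mat d d" using B by simp
      fix v assume v: "v \<in> carrier_vec d" "(1\<^sub>m d + B) *\<^sub>v v = 0\<^sub>v d"
      have "v + B *\<^sub>v v = 0\<^sub>v d"
        using v B by (simp add: add_mult_distrib_mat_vec[of _ d d])
      then have "scalar_prod v (v + B *\<^sub>v v) = 0" using v by simp
      then have "scalar_prod v v + scalar_prod v (B *\<^sub>v v) = 0"
        using v B by (simp add: scalar_prod_add_distrib[of _ d])
      then have "scalar_prod v v = 0"
        using acc[OF v(1)] scalar_prod_self_nonneg[of v] by linarith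
      then show "v = 0\<^sub>v d" using scalar_prod_self_eq_0[OF v(1)] by simp
    qed
    moreover have "det T \<noteq> 0" by (rule det_nonzero_if_right_inverse[OF T W TW])
    ultimately show ?thesis
      unfolding Pl using det_mult[OF T, of "1\<^sub>m d + B"] B by simp
  qed
  note invPl = matrix_inverse_det[OF PlC this]
  have invPr: "matrix_inverse Pr = W"
    unfolding Pr_def I_def[symmetric] T_def[symmetric] by (rule matrix_inverse_eqI[OF T W TW])
  define X where "X = matrix_inverse Pl * Mt * matrix_inverse Pr"
  have Mt: "Mt \<in> carrier_mat d d" unfolding Mt_def I_def[symmetric] using GI IA by simp
  have X: "X \<in> carrier_mat d d" unfolding X_def invPr using invPl Mt W by simp
  have "T * ((1\<^sub>m d + B) * X) = Pl * X"
    unfolding Pl using T B X by (simp add: assoc_mult_mat[of _ d d _ d _ d])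
  also have "\<dots> = (Pl * matrix_inverse Pl) * (Mt * W)"
    unfolding X_def invPr using invPl(1) PlC Mt W by (simp add: assoc_mult_mat[of _ d d _ d _ d])
  also have "\<dots> = T * (E + B)"
    unfolding invPl MW using T E B by simp
  finally have "T * ((1\<^sub>m d + B) * X) = T * (E + B)" .
  moreover have "W * (T * Y) = Y" if "Y \<in> carrier_mat d d" for Y
  proof -
    have "W * (T * Y) = (W * T) * Y" using W T that by (simp add: assoc_mult_mat[of _ d d _ d _ d])
    then show ?thesis using that by (simp add: WT)
  qed
  ultimately have eq: "(1\<^sub>m d + B) * X = E + B"
    using B X E by (metis add_carrier_mat mult_carrier_mat)
  show "invertible_mat (matrix_inverse Pl * Mt * matrix_inverse Pr)"
    "condition_number (matrix_inverse Pl * Mt * matrix_inverse Pr) \<le> 3"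
    using near_identity_condition[OF E symE B X low up acc eq] unfolding X_def by auto
qed

section \<open>Diagonal dominance\<close>

text \<open>
  Replace every off-diagonal term \<open>x\<^sub>i A\<^sub>i\<^sub>j x\<^sub>j\<close> by its lower bound \<open>-\<bar>A\<^sub>i\<^sub>j\<bar> \<bar>x\<^sub>i\<bar> \<bar>x\<^sub>j\<bar>\<close> and write \<open>2 \<bar>x\<^sub>i\<bar> \<bar>x\<^sub>j\<bar>\<close> as
  \<open>x\<^sub>i\<^sup>2 + x\<^sub>j\<^sup>2 - (\<bar>x\<^sub>i\<bar> - \<bar>x\<^sub>j\<bar>)\<^sup>2\<close>. For a matrix that is not symmetric the row and column
  sums of absolute values enter through their mean. Keeping the last square gives a usable bound also when dominance
  is strict in one row only.
\<close>

lemma quadratic_form_ge_dominance: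
  fixes A :: "nat \<Rightarrow> nat \<Rightarrow> real" and x :: "nat \<Rightarrow> real"
  shows "(\<Sum>i<n. (x i)\<^sup>2 * (A i i - (\<Sum>j\<in>{..<n} - {i}. (\<bar>A i j\<bar> + \<bar>A j i\<bar>) / 2)))
     + (\<Sum>i<n. \<Sum>j\<in>{..<n} - {i}. \<bar>A i j\<bar> * (\<bar>x i\<bar> - \<bar>x j\<bar>)\<^sup>2 / 2)
     \<le> (\<Sum>i<n. \<Sum>j<n. x i * A i j * x j)"
proof -
  define D where "D i j = (if i = j then 0 else \<bar>A i j\<bar>)" for i j
  have off: "(\<Sum>j\<in>{..<n} - {i}. f j) = (\<Sum>j<n. if i = j then 0 else f j)" for i and f :: "nat \<Rightarrow> real"
    by (intro sum.mono_neutral_cong_left) auto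
  have swap: "(\<Sum>i<n. \<Sum>j<n. (x i)\<^sup>2 * D j i) = (\<Sum>i<n. \<Sum>j<n. (x j)\<^sup>2 * D i j)"
    by (rule sum.swap)
  have row: "(x i)\<^sup>2 * (A i i - (\<Sum>j\<in>{..<n} - {i}. (\<bar>A i j\<bar> + \<bar>A j i\<bar>) / 2)) =
      (x i)\<^sup>2 * A i i - (\<Sum>j<n. (x i)\<^sup>2 * D i j) / 2 - (\<Sum>j<n. (x i)\<^sup>2 * D j i) / 2" for i
  proof -
    have "(\<Sum>j\<in>{..<n} - {i}. (\<bar>A i j\<bar> + \<bar>A j i\<bar>) / 2) = (\<Sum>j<n. D i j / 2 + D j i / 2)"
      unfolding off by (intro sum.cong) (auto simp: D_def)
    then show ?thesis
      by (simp add: sum.distrib sum_distrib_left sum_divide_distrib right_diff_distrib distrib_left)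
  qed
  have gap: "(\<Sum>j\<in>{..<n} - {i}. \<bar>A i j\<bar> * (\<bar>x i\<bar> - \<bar>x j\<bar>)\<^sup>2 / 2)
    = (\<Sum>j<n. (x i)\<^sup>2 * D i j) / 2 + (\<Sum>j<n. (x j)\<^sup>2 * D i j) / 2 - (\<Sum>j<n. D i j * \<bar>x i\<bar> * \<bar>x j\<bar>)" for i
  proof -
    have "(\<Sum>j\<in>{..<n} - {i}. \<bar>A i j\<bar> * (\<bar>x i\<bar> - \<bar>x j\<bar>)\<^sup>2 / 2)
      = (\<Sum>j<n. (x i)\<^sup>2 * D i j / 2 + (x j)\<^sup>2 * D i j / 2 - D i j * \<bar>x i\<bar> * \<bar>x j\<bar>)"
      unfolding off by (intro sum.cong) (auto simp: D_def power2_diff field_simps)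
    then show ?thesis
      by (simp add: sum.distrib sum_subtractf sum_divide_distrib)
  qed
  have "(\<Sum>i<n. (x i)\<^sup>2 * (A i i - (\<Sum>j\<in>{..<n} - {i}. (\<bar>A i j\<bar> + \<bar>A j i\<bar>) / 2)))
     + (\<Sum>i<n. \<Sum>j\<in>{..<n} - {i}. \<bar>A i j\<bar> * (\<bar>x i\<bar> - \<bar>x j\<bar>)\<^sup>2 / 2)
     = (\<Sum>i<n. (x i)\<^sup>2 * A i i - (\<Sum>j<n. D i j * \<bar>x i\<bar> * \<bar>x j\<bar>))
       + ((\<Sum>i<n. \<Sum>j<n. (x j)\<^sup>2 * D i j) / 2 - (\<Sum>i<n. \<Sum>j<n. (x i)\<^sup>2 * D j i) / 2)"
    unfolding row gap by (simp add: sum.distrib sum_subtractf sum_divide_distrib)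
  also have "\<dots> = (\<Sum>i<n. (x i)\<^sup>2 * A i i - (\<Sum>j<n. D i j * \<bar>x i\<bar> * \<bar>x j\<bar>))"
    unfolding swap by simp
  also have "\<dots> \<le> (\<Sum>i<n. \<Sum>j<n. x i * A i j * x j)"
  proof (rule sum_mono)
    fix i assume i: "i \<in> {..<n}"
    have "- (D i j * \<bar>x i\<bar> * \<bar>x j\<bar>) \<le> (if i = j then 0 else x i * A i j * x j)" for j
      using abs_ge_minus_self[of "x i * A i j * x j"] by (auto simp: D_def abs_mult mult_ac)
    then have "(\<Sum>j<n. - (D i j * \<bar>x i\<bar> * \<bar>x j\<bar>)) \<le> (\<Sum>j<n. if i = j then 0 else x i * A i j * x j)"
      by (intro sum_mono)
    also have "\<dots> = (\<Sum>j<n. x i * A i j * x j) - (x i)\<^sup>2 * A i i"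
      using i by (simp add: off[symmetric] sum_diff1 power2_eq_square mult_ac)
    finally show "(x i)\<^sup>2 * A i i - (\<Sum>j<n. D i j * \<bar>x i\<bar> * \<bar>x j\<bar>) \<le> (\<Sum>j<n. x i * A i j * x j)"
      by (simp add: sum_negf)
  qed
  finally show ?thesis .
qed

lemma quadratic_form_nonneg:
  fixes A :: "nat \<Rightarrow> nat \<Rightarrow> real" and x :: "nat \<Rightarrow> real"
  assumes "\<And>i. i < n \<Longrightarrow> (\<Sum>j\<in>{..<n} - {i}. (\<bar>A i j\<bar> + \<bar>A j i\<bar>) / 2) \<le> A i i"
  shows "0 \<le> (\<Sum>i<n. \<Sum>j<n. x i * A i j * x j)"
proof -
  have "0 \<le> (\<Sum>i<n. (x i)\<^sup>2 * (A i i - (\<Sum>j\<in>{..<n} - {i}. (\<bar>A i j\<bar> + \<bar>A j i\<bar>) / 2)))"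
    using assms by (intro sum_nonneg mult_nonneg_nonneg) auto
  moreover have "0 \<le> (\<Sum>i<n. \<Sum>j\<in>{..<n} - {i}. \<bar>A i j\<bar> * (\<bar>x i\<bar> - \<bar>x j\<bar>)\<^sup>2 / 2)"
    by (intro sum_nonneg) auto
  ultimately show ?thesis
    using quadratic_form_ge_dominance[of x A n] by linarith
qed

text \<open>
  Irreducible diagonal dominance along the chain \<open>0, 1, 2, ...\<close>: if the form is not positive, the
  strictly dominant row forces \<open>x\<^sub>0 = 0\<close>, and each nonzero \<open>A\<^sub>i\<^sub>,\<^sub>i\<^sub>+\<^sub>1\<close> carries \<open>\<bar>x\<^sub>i\<bar> = \<bar>x\<^sub>i\<^sub>+\<^sub>1\<bar>\<close> along. For \<open>\<beta> = 2\<close>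
  the interior rows of \<open>G\<^sub>\<tau>\<close> are not strictly dominant, so dominance row by row does not suffice.
\<close>

lemma quadratic_form_pos:
  fixes A :: "nat \<Rightarrow> nat \<Rightarrow> real" and x :: "nat \<Rightarrow> real"
  assumes dom: "\<And>i. i < n \<Longrightarrow> (\<Sum>j\<in>{..<n} - {i}. (\<bar>A i j\<bar> + \<bar>A j i\<bar>) / 2) \<le> A i i"
    and strict: "(\<Sum>j\<in>{..<n} - {0}. (\<bar>A 0 j\<bar> + \<bar>A j 0\<bar>) / 2) < A 0 0"
    and chain: "\<And>i. Suc i < n \<Longrightarrow> A i (Suc i) \<noteq> 0"
    and k: "k < n" "x k \<noteq> 0"
  shows "0 < (\<Sum>i<n. \<Sum>j<n. x i * A i j * x j)"
proof (rule ccontr)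
  assume neg: "\<not> ?thesis"
  define r where "r i = (x i)\<^sup>2 * (A i i - (\<Sum>j\<in>{..<n} - {i}. (\<bar>A i j\<bar> + \<bar>A j i\<bar>) / 2))" for i
  define d where "d i j = \<bar>A i j\<bar> * (\<bar>x i\<bar> - \<bar>x j\<bar>)\<^sup>2 / 2" for i j
  have r: "0 \<le> r i" if "i < n" for i
    using dom[OF that] by (simp add: r_def)
  have d: "0 \<le> (\<Sum>j\<in>{..<n} - {i}. d i j)" for i
    by (intro sum_nonneg) (simp add: d_def)
  have "(\<Sum>i<n. r i) + (\<Sum>i<n. \<Sum>j\<in>{..<n} - {i}. d i j) \<le> 0"
    using quadratic_form_ge_dominance[of x A n] neg by (simp add: r_def d_def)
  moreover have "0 \<le> (\<Sum>i<n. r i)" "0 \<le> (\<Sum>i<n. \<Sum>j\<in>{..<n} - {i}. d i j)"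
    using r d by (auto intro: sum_nonneg)
  ultimately have r0: "(\<Sum>i<n. r i) = 0" and d0: "(\<Sum>i<n. \<Sum>j\<in>{..<n} - {i}. d i j) = 0"
    by linarith+
  have "x i = 0" if "i < n" for i
    using that
  proof (induction i)
    case 0
    then have "r 0 = 0"
      using r0 r by (subst (asm) sum_nonneg_eq_0_iff) auto
    then show ?case using strict by (simp add: r_def)
  next
    case (Suc i)
    have "(\<Sum>j\<in>{..<n} - {i}. d i j) = 0"
      using d0 d Suc.prems by (subst (asm) sum_nonneg_eq_0_iff) auto
    then have "d i (Suc i) = 0"
      using Suc.prems by (subst (asm) sum_nonneg_eq_0_iff) (auto simp: d_def)
    then show ?case
      using chain[OF Suc.prems] Suc by (simp add: d_def)
  qed
  then show False using k by blast
qed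

section \<open>The temporal coefficients\<close>

text \<open>
  The form of Taylor's theorem behind the second-order estimates of the coefficients: an estimate for an interval
  of length one is proved for length \<open>u\<close> by differentiating twice in \<open>u\<close>.
\<close>

lemma nonneg_if_second_deriv_nonneg:
  fixes g g' g'' :: "real \<Rightarrow> real"
  assumes "\<And>u. 0 \<le> u \<Longrightarrow> u \<le> 1 \<Longrightarrow> (g has_real_derivative g' u) (at u)"
    and "\<And>u. 0 \<le> u \<Longrightarrow> u \<le> 1 \<Longrightarrow> (g' has_real_derivative g'' u) (at u)"
    and "\<And>u. 0 \<le> u \<Longrightarrow> u \<le> 1 \<Longrightarrow> 0 \<le> g'' u"
    and "g 0 = 0" "g' 0 = 0"
  shows "0 \<le> g 1"
proof -
  have "0 \<le> g' u" if "0 \<le> u" "u \<le> 1" for u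
  proof -
    have "g' 0 \<le> g' u"
      by (rule DERIV_nonneg_imp_nondecreasing[OF that(1)])
         (use that assms(2,3) in \<open>metis order_trans\<close>)
    then show ?thesis using assms(5) by simp
  qed
  note g'_nonneg = this
  have "g 0 \<le> g 1"
    by (rule DERIV_nonneg_imp_nondecreasing[OF zero_le_one]) (use assms(1) g'_nonneg in metis)
  then show ?thesis using assms(4) by simp
qed

text \<open>
  This is \<open>-f''(x)\<close> for the concave function \<open>f(x) = x\<^sup>1\<^sup>-\<^sup>\<alpha>\<close>. The coefficient \<open>a\<^sub>l\<close> is the increment of \<open>f\<close> over
  \<open>[l, l + 1]\<close>, and \<open>b\<^sub>l\<close> is the error of the trapezoidal rule for \<open>f\<close> on that interval, so the two are compared
  through \<open>f''\<close>.
\<close>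

definition curv :: "real \<Rightarrow> real \<Rightarrow> real" where
  "curv \<alpha> x = \<alpha> * (1 - \<alpha>) * x powr (- \<alpha> - 1)"

lemma curv_nonneg: "0 < \<alpha> \<Longrightarrow> \<alpha> < 1 \<Longrightarrow> 0 \<le> curv \<alpha> x"
  by (simp add: curv_def)

lemma curv_antimono:
  assumes "0 < \<alpha>" "\<alpha> < 1" "0 < x" "x \<le> y"
  shows "curv \<alpha> y \<le> curv \<alpha> x"
  unfolding curv_def using assms
  by (intro mult_left_mono powr_mono2') auto

lemma curv_le:
  assumes "0 < \<alpha>" "\<alpha> < 1" "1 \<le> x"
  shows "curv \<alpha> x \<le> \<alpha>"
proof -
  have "curv \<alpha> x \<le> curv \<alpha> 1" using assms by (intro curv_antimono) auto
  also have "\<dots> \<le> \<alpha>" using assms by (simp add: curv_def algebra_simps)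
  finally show ?thesis .
qed

text \<open>
  With \<open>E u\<close> the trapezoidal error over \<open>[x, x + u]\<close>, the second derivative of \<open>E\<close> is
  \<open>u (-f''(x + u)) / 2\<close>. It lies between 0 and \<open>u (-f''(x)) / 2\<close>, and two integrations give the constant
  \<open>1/12\<close>. The interval starting at 0 is excluded because \<open>f''\<close> is unbounded there.
\<close>

lemma b_coeff_bounds:
  assumes "0 < \<alpha>" "\<alpha> < 1" "1 \<le> l"
  shows "0 \<le> b_coeff \<alpha> l" and "b_coeff \<alpha> l \<le> curv \<alpha> (real l) / 12"
proof -
  define x where "x = real l"
  have x: "1 \<le> x" using assms by (simp add: x_def)
  define K where "K u = ((x + u) powr (2 - \<alpha>) - x powr (2 - \<alpha>)) / (2 - \<alpha>)" for u
  define E where "E u = K u - u * (x powr (1 - \<alpha>) + (x + u) powr (1 - \<alpha>)) / 2" for u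
  define E' where "E' u = ((x + u) powr (1 - \<alpha>) - x powr (1 - \<alpha>)) / 2
     - u * ((1 - \<alpha>) * (x + u) powr (- \<alpha>)) / 2" for u
  have E: "(E has_real_derivative E' u) (at u)" if "0 \<le> u" for u
  proof -
    have K: "(K has_real_derivative (x + u) powr (1 - \<alpha>)) (at u)"
    proof -
      have "((\<lambda>u. (x + u) powr (2 - \<alpha>) - x powr (2 - \<alpha>)) has_real_derivative
          (2 - \<alpha>) * (x + u) powr (1 - \<alpha>)) (at u)"
        using x that by (auto intro!: derivative_eq_intros)
      from DERIV_cdivide[OF this, of "2 - \<alpha>"] show ?thesis
        using assms by (simp add: K_def[abs_def])
    qed
    show ?thesis
      unfolding E_def E'_def using x that
      by (auto intro!: derivative_eq_intros K simp: field_simps)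
  qed
  have E': "(E' has_real_derivative u * curv \<alpha> (x + u) / 2) (at u)" if "0 \<le> u" for u
    unfolding E'_def curv_def using assms x that
    by (auto intro!: derivative_eq_intros simp: field_simps)
  have b: "b_coeff \<alpha> l = E 1"
    by (simp add: b_coeff_def E_def K_def x_def add_ac)
  show "0 \<le> b_coeff \<alpha> l"
    unfolding b
  proof (rule nonneg_if_second_deriv_nonneg[where g' = E' and g'' = "\<lambda>u. u * curv \<alpha> (x + u) / 2"])
    show "E 0 = 0" "E' 0 = 0" by (simp_all add: E_def E'_def K_def)
  qed (use E E' assms curv_nonneg in simp_all)
  have "0 \<le> (\<lambda>u. u ^ 3 * curv \<alpha> x / 12 - E u) 1"
  proof (rule nonneg_if_second_deriv_nonneg[where g' = "\<lambda>u. u ^ 2 * curv \<alpha> x / 4 - E' u" and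
         g'' = "\<lambda>u. u * curv \<alpha> x / 2 - u * curv \<alpha> (x + u) / 2"])
    fix u :: real assume u: "0 \<le> u" "u \<le> 1"
    show "((\<lambda>u. u ^ 3 * curv \<alpha> x / 12 - E u) has_real_derivative u ^ 2 * curv \<alpha> x / 4 - E' u) (at u)"
      using u by (auto intro!: derivative_eq_intros E)
    show "((\<lambda>u. u ^ 2 * curv \<alpha> x / 4 - E' u) has_real_derivative
        u * curv \<alpha> x / 2 - u * curv \<alpha> (x + u) / 2) (at u)"
      using u by (auto intro!: derivative_eq_intros E')
    have "curv \<alpha> (x + u) \<le> curv \<alpha> x"
      using curv_antimono assms x u by simp
    then show "0 \<le> u * curv \<alpha> x / 2 - u * curv \<alpha> (x + u) / 2"
      using u by (simp add: mult_left_mono)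
  qed (simp_all add: E_def E'_def K_def)
  then show "b_coeff \<alpha> l \<le> curv \<alpha> (real l) / 12"
    by (simp add: b x_def)
qed

lemma b_coeff_0_eq: 
  assumes "0 < \<alpha>" "\<alpha> < 1"
  shows "b_coeff \<alpha> 0 = \<alpha> / (2 * (2 - \<alpha>))"
  using assms by (simp add: b_coeff_def field_simps)

lemma b_coeff_0_bounds:
  assumes "0 < \<alpha>" "\<alpha> < 4/11"
  shows "\<alpha> / 4 \<le> b_coeff \<alpha> 0" "b_coeff \<alpha> 0 \<le> 1/8"
proof -
  show "\<alpha> / 4 \<le> b_coeff \<alpha> 0" "b_coeff \<alpha> 0 \<le> 1/8"
    using assms by (simp_all add: b_coeff_0_eq field_simps)
qed

lemma b_coeff_nonneg:
  assumes "0 < \<alpha>" "\<alpha> < 1"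
  shows "0 \<le> b_coeff \<alpha> l"
  using b_coeff_bounds(1)[of \<alpha> l] b_coeff_0_eq[of \<alpha>] assms by (cases l) auto

lemma b_coeff_le:
  assumes "0 < \<alpha>" "\<alpha> < 1" "1 \<le> l"
  shows "b_coeff \<alpha> l \<le> \<alpha> / 12"
  using b_coeff_bounds(2)[OF assms] curv_le[of \<alpha> "real l"] assms by simp

text \<open>
  The difference is the second difference of \<open>-f\<close> around \<open>y = k + 1\<close>. Its second derivative in the
  step size \<open>u\<close> is \<open>-f''(y - u) - f''(y + u)\<close>; keeping only the first term, which dominates
  \<open>-f''(y)\<close>, costs half of the sharp constant and is enough.
\<close>

lemma a_coeff_diff_ge:
  assumes "0 < \<alpha>" "\<alpha> < 1" "1 \<le> k"
  shows "a_coeff \<alpha> k - a_coeff \<alpha> (Suc k) \<ge> curv \<alpha> (real k + 1) / 2"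
proof -
  define y where "y = real k + 1"
  have y: "2 \<le> y" using assms by (simp add: y_def)
  define E where "E u = 2 * y powr (1 - \<alpha>) - (y - u) powr (1 - \<alpha>) - (y + u) powr (1 - \<alpha>)
     - u ^ 2 * curv \<alpha> y / 2" for u
  define E' where "E' u = (1 - \<alpha>) * ((y - u) powr (- \<alpha>) - (y + u) powr (- \<alpha>)) - u * curv \<alpha> y" for u
  have "0 \<le> E 1"
  proof (rule nonneg_if_second_deriv_nonneg[where g' = E' and
        g'' = "\<lambda>u. curv \<alpha> (y - u) + curv \<alpha> (y + u) - curv \<alpha> y"])
    fix u :: real assume u: "0 \<le> u" "u \<le> 1"
    show "(E has_real_derivative E' u) (at u)"
      unfolding E_def E'_def using assms y u
      by (auto intro!: derivative_eq_intros simp: field_simps)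
    show "(E' has_real_derivative curv \<alpha> (y - u) + curv \<alpha> (y + u) - curv \<alpha> y) (at u)"
      unfolding E'_def curv_def using assms y u
      by (auto intro!: derivative_eq_intros simp: field_simps)
    show "0 \<le> curv \<alpha> (y - u) + curv \<alpha> (y + u) - curv \<alpha> y"
      using curv_antimono[of \<alpha> "y - u" y] curv_nonneg[of \<alpha> "y + u"] assms y u by simp
  qed (simp_all add: E_def E'_def)
  then show ?thesis
    by (simp add: a_coeff_def E_def y_def algebra_simps)
qed

lemma a_coeff_ge_curv:
  assumes "0 < \<alpha>" "\<alpha> < 1" "1 \<le> k"
  shows "a_coeff \<alpha> k \<ge> curv \<alpha> (real k + 1)"
proof -
  have "\<exists>z>real k. z < real k + 1 \<and> (real k + 1) powr (1 - \<alpha>) - (real k) powr (1 - \<alpha>)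
       = (real k + 1 - real k) * ((1 - \<alpha>) * z powr (- \<alpha>))"
    using assms by (intro MVT2) (auto intro!: derivative_eq_intros simp: field_simps)
  then obtain z where z: "real k < z" "z < real k + 1"
     "a_coeff \<alpha> k = (1 - \<alpha>) * z powr (- \<alpha>)" by (auto simp: a_coeff_def)
  have "\<alpha> * (real k + 1) powr (- \<alpha> - 1) \<le> 1 * (real k + 1) powr (- \<alpha>)"
    using assms by (intro mult_mono powr_mono) auto
  also have "\<dots> \<le> z powr (- \<alpha>)"
    using assms z by (simp add: powr_mono2')
  finally have "\<alpha> * (real k + 1) powr (- \<alpha> - 1) \<le> z powr (- \<alpha>)" .
  moreover have "0 \<le> 1 - \<alpha>" using assms by simp
  ultimately have "(1 - \<alpha>) * (\<alpha> * (real k + 1) powr (- \<alpha> - 1)) \<le> (1 - \<alpha>) * z powr (- \<alpha>)"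
    by (rule mult_left_mono)
  then show ?thesis
    by (simp add: z(3) curv_def mult_ac)
qed

text \<open>
  \<open>3\<^sup>1\<^sup>5 \<le> 5\<^sup>1\<^sup>1\<close>; the exponent is \<open>1 + \<alpha>\<close> at the end point \<open>\<alpha> = 4/11\<close>.
\<close>

lemma three_powr_le_5: "(3::real) powr (15/11) \<le> 5"
proof -
  define p where "p = (3::real) powr (15/11)"
  have p: "p ^ 11 = 3 ^ 15"
    using powr_power[of "3::real" "15/11" 11] powr_realpow[of "3::real" 15]
    by (simp add: p_def)
  have "p \<le> 5"
  proof (rule ccontr)
    assume "\<not> p \<le> 5"
    then have "5 ^ 11 < p ^ 11"
      by (intro power_strict_mono) simp_all
    then show False unfolding p by simp
  qed
  then show ?thesis by (simp add: p_def)
qed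

text \<open>
  For \<open>k \<ge> 2\<close> the two arguments differ at most by the factor 3, attained at \<open>k = 2\<close>.
\<close>

lemma curv_ratio:
  assumes "0 < \<alpha>" "\<alpha> < 4/11" "2 \<le> k"
  shows "curv \<alpha> (real k - 1) \<le> 5 * curv \<alpha> (real k + 1)"
proof -
  have "(real k + 1) powr (\<alpha> + 1) \<le> (3 * (real k - 1)) powr (\<alpha> + 1)"
    using assms by (intro powr_mono2) auto
  also have "\<dots> = 3 powr (\<alpha> + 1) * (real k - 1) powr (\<alpha> + 1)"
    by (rule powr_mult)
  also have "\<dots> \<le> 5 * (real k - 1) powr (\<alpha> + 1)"
  proof (rule mult_right_mono)
    have "3 powr (\<alpha> + 1) \<le> (3::real) powr (15/11)"
      using assms by (intro powr_mono) auto
    then show "3 powr (\<alpha> + 1) \<le> (5::real)"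
      using three_powr_le_5 by linarith
  qed simp
  finally have "(real k + 1) powr (\<alpha> + 1) \<le> 5 * (real k - 1) powr (\<alpha> + 1)" .
  moreover have "0 < (real k + 1) powr (\<alpha> + 1)" "0 < (real k - 1) powr (\<alpha> + 1)"
    using assms by simp_all
  ultimately have "(real k - 1) powr (- (\<alpha> + 1)) \<le> 5 * (real k + 1) powr (- (\<alpha> + 1))"
    unfolding powr_minus_divide by (simp add: divide_simps)
  moreover have "0 \<le> \<alpha> * (1 - \<alpha>)" using assms by simp
  ultimately have "\<alpha> * (1 - \<alpha>) * (real k - 1) powr (- (\<alpha> + 1))
     \<le> \<alpha> * (1 - \<alpha>) * (5 * (real k + 1) powr (- (\<alpha> + 1)))"
    by (intro mult_left_mono)
  then show ?thesis
    by (simp add: curv_def)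
qed

text \<open>
  The factor 5 from the previous lemma makes the two trapezoidal errors together at most
  \<open>(5 + 1) / 12\<close> of the curvature at \<open>k + 1\<close>, which is exactly the lower bound available for
  \<open>a\<^sub>k - a\<^sub>k\<^sub>+\<^sub>1\<close>.
\<close>

lemma b_coeff_neighbours:
  assumes "0 < \<alpha>" "\<alpha> < 4/11" "2 \<le> k"
  shows "b_coeff \<alpha> (k - 1) + b_coeff \<alpha> (k + 1) \<le> curv \<alpha> (real k + 1) / 2"
proof -
  have "b_coeff \<alpha> (k - 1) \<le> curv \<alpha> (real (k - 1)) / 12" "b_coeff \<alpha> (k + 1) \<le> curv \<alpha> (real (k + 1)) / 12"
    using assms by (intro b_coeff_bounds; simp)+
  then show ?thesis
    using curv_ratio[OF assms] assms by (simp add: of_nat_diff add_ac)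
qed

text \<open>
  The bound \<open>-f''(l)\<close> on \<open>b\<^sub>l\<close> telescopes: it is at most the drop of \<open>f'\<close> over \<open>[l - 1, l]\<close>, and \<open>f'(1) < 1\<close>.
\<close>

lemma sum_b_coeff_le:
  assumes "0 < \<alpha>" "\<alpha> < 1"
  shows "(\<Sum>k<n. b_coeff \<alpha> (k + 2)) \<le> 1"
proof -
  have curv: "curv \<alpha> (x + 1) \<le> (1 - \<alpha>) * x powr (- \<alpha>) - (1 - \<alpha>) * (x + 1) powr (- \<alpha>)" if "1 \<le> x" for x
  proof -
    have "\<exists>z>x. z < x + 1 \<and> - ((1 - \<alpha>) * (x + 1) powr (- \<alpha>)) - - ((1 - \<alpha>) * x powr (- \<alpha>))
       = (x + 1 - x) * curv \<alpha> z"
      using assms that unfolding curv_def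
      by (intro MVT2) (auto intro!: derivative_eq_intros simp: field_simps)
    then obtain z where z: "x < z" "z < x + 1"
      "(1 - \<alpha>) * x powr (- \<alpha>) - (1 - \<alpha>) * (x + 1) powr (- \<alpha>) = curv \<alpha> z"
      by (metis add_diff_cancel_left' diff_minus_eq_add mult_1 uminus_add_conv_diff)
    show ?thesis unfolding z(3) using z assms that by (intro curv_antimono) auto
  qed
  have "(\<Sum>k<n. b_coeff \<alpha> (k + 2)) \<le> (1 - \<alpha>) - (1 - \<alpha>) * (real n + 1) powr (- \<alpha>)"
  proof (induction n)
    case (Suc n)
    have "b_coeff \<alpha> (n + 2) \<le> curv \<alpha> (real n + 1 + 1)"
      using b_coeff_bounds(2)[of \<alpha> "n + 2"] curv_nonneg[of \<alpha> "real n + 2"] assms by (simp add: add_ac)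
    then show ?case using Suc curv[of "real n + 1"] by (simp add: add_ac)
  qed simp
  also have "\<dots> \<le> 1"
  proof -
    have "0 \<le> (1 - \<alpha>) * (real n + 1) powr (- \<alpha>)" using assms by simp
    then show ?thesis using assms by linarith
  qed
  finally show ?thesis .
qed

text \<open>
  These are \<open>2\<^sup>1\<^sup>1 \<le> 3\<^sup>7\<close> and \<open>3\<^sup>5 \<le> 2\<^sup>8\<close>.
\<close>

lemma ln_three_bounds:
  shows "11/7 * ln 2 \<le> ln (3::real)" and "ln (3::real) \<le> 8/5 * ln 2"
proof -
  have "11 * ln 2 = ln ((2::real) ^ 11)" by (subst ln_realpow) simp_all
  also have "\<dots> \<le> ln ((3::real) ^ 7)" by (subst ln_le_cancel_iff) simp_all
  also have "\<dots> = 7 * ln 3" by (subst ln_realpow) simp_all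
  finally show "11/7 * ln 2 \<le> ln (3::real)" by simp
  have "5 * ln 3 = ln ((3::real) ^ 5)" by (subst ln_realpow) simp_all
  also have "\<dots> \<le> ln ((2::real) ^ 8)" by (subst ln_le_cancel_iff) simp_all
  also have "\<dots> = 8 * ln 2" by (subst ln_realpow) simp_all
  finally show "ln (3::real) \<le> 8/5 * ln 2" by simp
qed

text \<open>
  Up to a positive factor, the expression is \<open>c\<^sub>1 - c\<^sub>2\<close>. It vanishes at \<open>\<alpha> = 0\<close> and is concave on the
  interval, so its sign at the right end point decides. The end point \<open>4/11\<close> lies between \<open>0.3624\<close> and
  the zero of the expression near \<open>0.374\<close>; there the powers \<open>2\<^sup>-\<^sup>\<alpha>\<close> and \<open>3\<^sup>-\<^sup>\<alpha>\<close> have rational eleventh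
  powers, so that the value can be bounded by exact arithmetic.
\<close>

lemma powr_two_three_gap_nonneg:
  fixes \<alpha> :: real
  assumes "0 \<le> \<alpha>" "\<alpha> \<le> 4/11"
  shows "0 \<le> 2 powr (-\<alpha>) * (12 - 2 * \<alpha>) - 3 powr (-\<alpha>) * (8 - \<alpha>) - (4 - \<alpha>)"
proof -
  define p q where "p x = (2::real) powr (- x)" and "q x = (3::real) powr (- x)" for x :: real
  define f where "f x = q x * (8 - x) + (4 - x) - p x * (12 - 2 * x)" for x
  define L K where "L = ln (2::real)" and "K = ln (3::real)"
  have L: "2/3 \<le> L" "L \<le> 25/36" and K: "11/7 * L \<le> K" "K \<le> 8/5 * L"
    using ln2_ge_two_thirds ln2_le_25_over_36 ln_three_bounds by (simp_all add: L_def K_def)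
  define f' where "f' x = - (K * q x * (8 - x)) - q x - 1 + L * p x * (12 - 2 * x) + 2 * p x" for x
  define f'' where "f'' x = q x * (K * K * (8 - x) + 2 * K) - p x * (L * L * (12 - 2 * x) + 4 * L)" for x
  have dp: "(p has_real_derivative - L * p x) (at x)" and dq: "(q has_real_derivative - K * q x) (at x)" for x
    unfolding p_def q_def L_def K_def by (auto intro!: derivative_eq_intros)
  have "convex_on {0..4/11} f"
  proof (rule f''_ge0_imp_convex)
    fix x :: real assume "x \<in> {0..4/11}"
    then have x: "0 \<le> x" "x \<le> 4/11" by auto
    show "(f has_real_derivative f' x) (at x)"
      unfolding f_def f'_def by (auto intro!: derivative_eq_intros dp dq simp: algebra_simps)
    show "(f' has_real_derivative f'' x) (at x)"
      unfolding f'_def f''_def by (auto intro!: derivative_eq_intros dp dq simp: algebra_simps)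
    \<comment> \<open>Concavity amounts to \<open>p x (L\<^sup>2 (12 - 2 x) + 4 L) \<le> q x (K\<^sup>2 (8 - x) + 2 K)\<close>. Since
      \<open>q x / p x = exp (- x (K - L))\<close> stays above \<open>21/25\<close>, crude bounds on \<open>L\<close> and \<open>K\<close> suffice.\<close>
    have "x * (K - L) \<le> 4/11 * (5/12)"
      using x L K by (intro mult_mono) auto
    moreover have "1 - x * (K - L) \<le> exp (- x * (K - L))"
      using exp_ge_add_one_self[of "- x * (K - L)"] by simp
    ultimately have "21/25 \<le> exp (- x * (K - L))" by simp
    then have "21/25 * p x \<le> exp (- x * (K - L)) * p x"
      by (intro mult_right_mono) (simp_all add: p_def)
    also have "\<dots> = q x"
      by (simp add: p_def q_def powr_def L_def K_def algebra_simps flip: exp_add)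
    finally have pq: "21/25 * p x \<le> q x" .
    have "L * (12 - 2 * x) + 4 \<le> 25/36 * 12 + 4"
      using x L by (intro add_mono mult_mono) auto
    then have "L * (L * (12 - 2 * x) + 4) \<le> L * (25/36 * 12 + 4)"
      using L by (intro mult_left_mono) auto
    also have "\<dots> \<le> 21/25 * (11/7 * L * (11/7 * (2/3)) * (84/11) + 2 * (11/7 * L))"
      using L by simp
    also have "\<dots> \<le> 21/25 * (K * K * (8 - x) + 2 * K)"
      using x L K by (intro mult_left_mono add_mono mult_mono) auto
    finally have "L * (L * (12 - 2 * x) + 4) \<le> 21/25 * (K * K * (8 - x) + 2 * K)" .
    then have "p x * (L * (L * (12 - 2 * x) + 4)) \<le> p x * (21/25 * (K * K * (8 - x) + 2 * K))"
      by (intro mult_left_mono) (simp_all add: p_def)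
    also have "\<dots> = 21/25 * p x * (K * K * (8 - x) + 2 * K)" by simp
    also have "\<dots> \<le> q x * (K * K * (8 - x) + 2 * K)"
      using pq L K x by (intro mult_right_mono) auto
    finally show "0 \<le> f'' x"
      unfolding f''_def by (simp add: algebra_simps)
  qed simp
  moreover have "f 0 = 0" by (simp add: f_def p_def q_def)
  moreover have "f (4/11) \<le> 0"
  proof -
    \<comment> \<open>The comparisons are \<open>0.7772\<^sup>1\<^sup>1 \<le> 1/16\<close> and \<open>1/81 \<le> 0.6707\<^sup>1\<^sup>1\<close>.\<close>
    have "0.7772 \<le> p (4/11)"
    proof (rule ccontr)
      assume "\<not> 0.7772 \<le> p (4/11)"
      then have "p (4/11) ^ 11 < 0.7772 ^ 11"
        by (intro power_strict_mono) (simp_all add: p_def)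
      moreover have "p (4/11) ^ 11 = 1 / 2 ^ 4"
        using powr_power[of "2::real" "-4/11" 11] powr_realpow[of "2::real" 4]
        by (simp add: p_def powr_minus_divide)
      ultimately show False by (simp add: power_divide)
    qed
    moreover have "q (4/11) \<le> 0.6707"
    proof (rule ccontr)
      assume "\<not> q (4/11) \<le> 0.6707"
      then have "0.6707 ^ 11 < q (4/11) ^ 11"
        by (intro power_strict_mono) (simp_all add: q_def)
      moreover have "q (4/11) ^ 11 = 1 / 3 ^ 4"
        using powr_power[of "3::real" "-4/11" 11] powr_realpow[of "3::real" 4]
        by (simp add: q_def powr_minus_divide)
      ultimately show False by (simp add: power_divide)
    qed
    ultimately show ?thesis by (simp add: f_def)
  qed
  ultimately have "f \<alpha> \<le> 0"
  proof -
    assume cv: "convex_on {0..4/11} f" and 0: "f 0 = 0" and e: "f (4/11) \<le> 0"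
    define t where "t = \<alpha> * 11 / 4"
    have t: "0 \<le> t" "t \<le> 1" and \<alpha>: "\<alpha> = (1 - t) *\<^sub>R 0 + t *\<^sub>R (4/11)"
      using assms by (simp_all add: t_def)
    have "f \<alpha> \<le> (1 - t) * f 0 + t * f (4/11)"
      unfolding \<alpha> using t by (intro convex_onD[OF cv]) auto
    also have "\<dots> \<le> 0" using 0 e t by (simp add: mult_nonneg_nonpos)
    finally show ?thesis .
  qed
  then show ?thesis by (simp add: f_def p_def q_def)
qed

text \<open>
  For \<open>k \<ge> 2\<close> the second difference of \<open>f\<close> in \<open>a\<^sub>k - a\<^sub>k\<^sub>+\<^sub>1\<close> outweighs the trapezoidal errors. The cases
  \<open>k = 0\<close> and \<open>k = 1\<close> involve \<open>b\<^sub>0\<close>, for which the curvature bound is void, and are treated by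
  explicit formulas.
\<close>

lemma c_coeff_Suc_le:
  assumes "0 < \<alpha>" "\<alpha> < 4/11"
  shows "c_coeff \<alpha> (Suc k) \<le> c_coeff \<alpha> k"
proof -
  consider "k = 0" | "k = 1" | "2 \<le> k" by linarith
  then show ?thesis
  proof cases
    case 1
    have "a_coeff \<alpha> 1 \<le> 1"
      using assms powr_mono[of "1 - \<alpha>" 1 "2::real"] by (simp add: a_coeff_def)
    moreover have "b_coeff \<alpha> 1 \<le> \<alpha> / 12" using assms by (intro b_coeff_le) auto
    ultimately show ?thesis
      using 1 b_coeff_0_bounds[OF assms] assms by (simp add: c_coeff_def a_coeff_def)
  next
    case 2
    define p q where "p = (2::real) powr (- \<alpha>)" and "q = (3::real) powr (- \<alpha>)"
    have pw: "(2::real) powr (1 - \<alpha>) = 2 * p" "(2::real) powr (2 - \<alpha>) = 4 * p"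
      "(3::real) powr (1 - \<alpha>) = 3 * q" "(3::real) powr (2 - \<alpha>) = 9 * q"
      by (simp_all add: p_def q_def powr_diff powr_minus field_simps)
    have D: "2 * (2 - \<alpha>) * (c_coeff \<alpha> 1 - c_coeff \<alpha> 2)
      = 3 * (p * (12 - 2 * \<alpha>) - q * (8 - \<alpha>) - (4 - \<alpha>))"
    proof -
      \<comment> \<open>Multiplication by \<open>2 - \<alpha>\<close> removes the denominator of the \<open>b\<^sub>l\<close>, leaving a polynomial identity in
        \<open>\<alpha>\<close>, \<open>p\<close> and \<open>q\<close>.\<close>
      have scale: "(2 - \<alpha>) * (1 / (2 - \<alpha>) * y) = y" for y :: real
        using assms by simp
      have scale_b: "(2 - \<alpha>) * b_coeff \<alpha> l = ((real l + 1) powr (2 - \<alpha>) - real l powr (2 - \<alpha>))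
          - (2 - \<alpha>) * (1 / 2 * ((real l + 1) powr (1 - \<alpha>) + real l powr (1 - \<alpha>)))" for l
        unfolding b_coeff_def right_diff_distrib[of "2 - \<alpha>"] scale by (rule refl)
      have B: "(2 - \<alpha>) * b_coeff \<alpha> 0 = \<alpha> / 2"
        "(2 - \<alpha>) * b_coeff \<alpha> 1 = (4 * p - 1) - (2 - \<alpha>) * (1 / 2 * (2 * p + 1))"
        "(2 - \<alpha>) * b_coeff \<alpha> 2 = (9 * q - 4 * p) - (2 - \<alpha>) * (1 / 2 * (3 * q + 2 * p))"
        unfolding scale_b using assms by (simp_all add: pw field_simps)
      have C: "c_coeff \<alpha> 1 - c_coeff \<alpha> 2 = 4 * p - 3 * q - 1 - b_coeff \<alpha> 2 + 2 * b_coeff \<alpha> 1 - b_coeff \<alpha> 0"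
        by (simp add: c_coeff_def a_coeff_def pw)
      have "2 * (2 - \<alpha>) * (c_coeff \<alpha> 1 - c_coeff \<alpha> 2) = 2 * (2 - \<alpha>) * (4 * p - 3 * q - 1)
          - 2 * ((2 - \<alpha>) * b_coeff \<alpha> 2) + 4 * ((2 - \<alpha>) * b_coeff \<alpha> 1) - 2 * ((2 - \<alpha>) * b_coeff \<alpha> 0)"
        unfolding C by (simp add: algebra_simps)
      also have "\<dots> = 3 * (p * (12 - 2 * \<alpha>) - q * (8 - \<alpha>) - (4 - \<alpha>))"
        unfolding B by (simp add: field_simps)
      finally show ?thesis .
    qed
    have "0 \<le> 2 * (2 - \<alpha>) * (c_coeff \<alpha> 1 - c_coeff \<alpha> 2)"
      unfolding D using powr_two_three_gap_nonneg[of \<alpha>] assms by (simp add: p_def q_def)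
    then show ?thesis using 2 assms by (simp add: zero_le_mult_iff numeral_2_eq_2)
  next
    case 3
    have "curv \<alpha> (real k + 1) / 2 \<le> a_coeff \<alpha> k - a_coeff \<alpha> (Suc k)"
      using assms 3 by (intro a_coeff_diff_ge) auto
    moreover have "c_coeff \<alpha> k - c_coeff \<alpha> (Suc k)
       = a_coeff \<alpha> k - a_coeff \<alpha> (Suc k) - (b_coeff \<alpha> (k - 1) + b_coeff \<alpha> (k + 1)) + 2 * b_coeff \<alpha> k"
      using 3 by (simp add: c_coeff_def)
    ultimately show ?thesis
      using b_coeff_neighbours[OF assms 3] b_coeff_nonneg[of \<alpha> k] assms by simp
  qed
qed

text \<open>
  In the first column of \<open>A\<^sub>t\<close> the entries exceed the Toeplitz pattern by \<open>b\<^sub>k\<^sub>+\<^sub>1\<close>; this inequality says that the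
  excess is paid for by what the telescoping sum of a row leaves over.
\<close>

lemma c_coeff_ge_b:
  assumes "0 < \<alpha>" "\<alpha> < 4/11"
  shows "b_coeff \<alpha> (Suc k) \<le> c_coeff \<alpha> k"
proof -
  consider "k = 0" | "k = 1" | "2 \<le> k" by linarith
  then show ?thesis
  proof cases
    case 1
    have "b_coeff \<alpha> 1 \<le> \<alpha> / 12" using assms by (intro b_coeff_le) auto
    then show ?thesis
      using 1 b_coeff_0_bounds[OF assms] assms by (simp add: c_coeff_def a_coeff_def)
  next
    case 2
    have "b_coeff \<alpha> 2 \<le> \<alpha> / 12" using assms by (intro b_coeff_le) auto
    moreover have "1/4 \<le> a_coeff \<alpha> 1"
    proof -
      have "5/4 \<le> (2::real) powr (1/2)"
        unfolding powr_half_sqrt[OF zero_le_numeral] by (rule real_le_rsqrt) (simp add: power2_eq_square)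
      also have "\<dots> \<le> (2::real) powr (1 - \<alpha>)"
        using assms by (intro powr_mono) auto
      finally show ?thesis by (simp add: a_coeff_def)
    qed
    ultimately show ?thesis
      using 2 b_coeff_0_bounds[OF assms] b_coeff_nonneg[of \<alpha> 1] assms by (simp add: c_coeff_def numeral_2_eq_2)
  next
    case 3
    have "curv \<alpha> (real k + 1) \<le> a_coeff \<alpha> k"
      using assms 3 by (intro a_coeff_ge_curv) auto
    then show ?thesis
      using b_coeff_neighbours[OF assms 3] b_coeff_nonneg[of \<alpha> k] curv_nonneg[of \<alpha> "real k + 1"] assms 3 
      by (simp add: c_coeff_def)
  qed
qed

section \<open>The temporal matrix\<close>

text \<open>
  The entries of \<open>A\<^sub>t / \<sigma>\<close>. They use \<open>c_tilde_coeff \<alpha> k = c_coeff \<alpha> k + b_coeff \<alpha> (k + 1)\<close>, so that the first column is the Toeplitz column plus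
  a correction.
\<close>

definition A_t_entry :: "real \<Rightarrow> nat \<Rightarrow> nat \<Rightarrow> real" where
  "A_t_entry \<alpha> i j =
    (if i < j then 0
     else if i = j then c_coeff \<alpha> 0 + (if j = 0 then b_coeff \<alpha> 1 else 0)
     else c_coeff \<alpha> (i - j) - c_coeff \<alpha> (i - j - 1) + (if j = 0 then b_coeff \<alpha> (i + 1) else 0))"

lemma A_t_carrier: "2 \<le> M \<Longrightarrow> A_t \<alpha> \<sigma> M \<in> carrier_mat (M - 1) (M - 1)"
  by (intro carrier_matI) (auto simp: A_t_def)

lemma A_t_index:
  assumes "2 \<le> M" "i < M - 1" "j < M - 1"
  shows "A_t \<alpha> \<sigma> M $$ (i, j) = \<sigma> * A_t_entry \<alpha> i j"
proof -
  have "c_tilde_coeff \<alpha> 0 = c_coeff \<alpha> 0 + b_coeff \<alpha> 1"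
    by (simp add: c_tilde_coeff_def c_coeff_def)
  moreover have "c_tilde_coeff \<alpha> (Suc k) = c_coeff \<alpha> (Suc k) + b_coeff \<alpha> (Suc (Suc k))" for k
    by (simp add: c_tilde_coeff_def c_coeff_def)
  moreover have "i - 1 < M - 2 \<or> i = 0" "j - 1 < M - 2 \<or> j = 0" using assms by auto
  ultimately show ?thesis
    using assms unfolding A_t_def A_t_entry_def
    by (cases i; cases j) (simp_all add: index_mat_four_block(1))
qed

text \<open>
  Below the diagonal the absolute values are at most the differences \<open>c\<^sub>k\<^sub>-\<^sub>1 - c\<^sub>k\<close>, plus a \<open>b\<close> in the first column.
  Rows and columns telescope: a row adds up to at most \<open>c\<^sub>0 - c\<^sub>i + b\<^sub>i\<^sub>+\<^sub>1 \<le> c\<^sub>0\<close>, every column but the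
  first to at most \<open>c\<^sub>0\<close>, and the first to at most \<open>c\<^sub>0 + 1\<close>, where row 0 contributes nothing and
  \<open>c\<^sub>0 \<ge> 1\<close> balances the surplus.
\<close>

lemma A_t_entry_dominance:
  assumes \<alpha>: "0 < \<alpha>" "\<alpha> < 4/11" and i: "i < m"
  shows "(\<Sum>j\<in>{..<m} - {i}. (\<bar>A_t_entry \<alpha> i j\<bar> + \<bar>A_t_entry \<alpha> j i\<bar>) / 2) \<le> A_t_entry \<alpha> i i"
proof -
  note cge = c_coeff_ge_b[OF \<alpha>] and dec = c_coeff_Suc_le[OF \<alpha>]
  have bge: "0 \<le> b_coeff \<alpha> k" for k using b_coeff_nonneg[of \<alpha> k] \<alpha> by simp
  have c0: "0 \<le> c_coeff \<alpha> k" for k using cge[of k] bge[of "Suc k"] by simp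
  define D where "D i j = c_coeff \<alpha> (i - Suc j) - c_coeff \<alpha> (i - j) + (if j = 0 then b_coeff \<alpha> (i + 1) else 0)" for i j
  have le: "\<bar>A_t_entry \<alpha> i j\<bar> \<le> D i j" if "j < i" for i j
  proof -
    have "c_coeff \<alpha> (i - j) \<le> c_coeff \<alpha> (i - Suc j)"
      using dec[of "i - Suc j"] that by (simp add: Suc_diff_Suc)
    then show ?thesis
      using that bge[of "Suc i"] by (auto simp: A_t_entry_def D_def)
  qed
  have upper: "A_t_entry \<alpha> i j = 0" if "i < j" for i j
    using that by (simp add: A_t_entry_def)
  have row: "(\<Sum>j<i. D i j) = c_coeff \<alpha> 0 - c_coeff \<alpha> i + (if i = 0 then 0 else b_coeff \<alpha> (i + 1))" for i
  proof -
    have "(\<Sum>j<i. c_coeff \<alpha> (i - Suc j) - c_coeff \<alpha> (i - j)) = c_coeff \<alpha> 0 - c_coeff \<alpha> i"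
      using sum_lessThan_telescope[of "\<lambda>j. c_coeff \<alpha> (i - j)" i] by simp
    then show ?thesis
      by (simp add: D_def sum.distrib sum.delta)
  qed
  have col: "(\<Sum>j\<in>{i<..<m}. D j i) = c_coeff \<alpha> 0 - c_coeff \<alpha> (m - Suc i)
      + (if i = 0 then (\<Sum>k<m - Suc i. b_coeff \<alpha> (k + 2)) else 0)"
  proof -
    have "(\<Sum>j\<in>{i<..<m}. D j i) = (\<Sum>k<m - Suc i. D (k + Suc i) i)"
      by (rule sum.reindex_bij_witness[of _ "\<lambda>k. k + Suc i" "\<lambda>j. j - Suc i"]) auto
    also have "\<dots> = (\<Sum>k<m - Suc i. c_coeff \<alpha> k - c_coeff \<alpha> (Suc k))
        + (\<Sum>k<m - Suc i. if i = 0 then b_coeff \<alpha> (k + 2) else 0)"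
      unfolding sum.distrib[symmetric] by (intro sum.cong) (auto simp: D_def)
    also have "(\<Sum>k<m - Suc i. c_coeff \<alpha> k - c_coeff \<alpha> (Suc k)) = c_coeff \<alpha> 0 - c_coeff \<alpha> (m - Suc i)"
      by (rule sum_lessThan_telescope')
    finally show ?thesis by simp
  qed
  have split: "{..<m} - {i} = {..<i} \<union> {i<..<m}" using i by auto
  have "(\<Sum>j\<in>{..<m} - {i}. (\<bar>A_t_entry \<alpha> i j\<bar> + \<bar>A_t_entry \<alpha> j i\<bar>) / 2)
     = (\<Sum>j<i. (\<bar>A_t_entry \<alpha> i j\<bar> + \<bar>A_t_entry \<alpha> j i\<bar>) / 2) + (\<Sum>j\<in>{i<..<m}. (\<bar>A_t_entry \<alpha> i j\<bar> + \<bar>A_t_entry \<alpha> j i\<bar>) / 2)"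
    unfolding split by (rule sum.union_disjoint) auto
  also have "\<dots> \<le> (\<Sum>j<i. D i j / 2) + (\<Sum>j\<in>{i<..<m}. D j i / 2)"
  proof (intro add_mono sum_mono)
    fix j assume "j \<in> {..<i}"
    then show "(\<bar>A_t_entry \<alpha> i j\<bar> + \<bar>A_t_entry \<alpha> j i\<bar>) / 2 \<le> D i j / 2"
      using le[of j i] upper[of j i] by simp
  next
    fix j assume "j \<in> {i<..<m}"
    then show "(\<bar>A_t_entry \<alpha> i j\<bar> + \<bar>A_t_entry \<alpha> j i\<bar>) / 2 \<le> D j i / 2"
      using le[of i j] upper[of i j] by simp
  qed
  also have "\<dots> = ((\<Sum>j<i. D i j) + (\<Sum>j\<in>{i<..<m}. D j i)) / 2"
    by (simp only: sum_divide_distrib add_divide_distrib)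
  also have "\<dots> \<le> A_t_entry \<alpha> i i"
  proof (cases "i = 0")
    case True
    have "1 \<le> c_coeff \<alpha> 0" using bge[of 0] by (simp add: c_coeff_def a_coeff_def)
    moreover have "A_t_entry \<alpha> i i = c_coeff \<alpha> 0 + b_coeff \<alpha> 1"
      using True by (simp add: A_t_entry_def)
    moreover have "(\<Sum>k<m - Suc i. b_coeff \<alpha> (k + 2)) \<le> 1"
      using \<alpha> by (intro sum_b_coeff_le) auto
    ultimately show ?thesis
      unfolding row col using True c0[of "m - Suc i"] bge[of 1] by simp
  next
    case False
    then have "A_t_entry \<alpha> i i = c_coeff \<alpha> 0" by (simp add: A_t_entry_def)
    then show ?thesis
      unfolding row col using False cge[of i] c0[of "m - Suc i"] by simp
  qed
  finally show ?thesis .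
qed

lemma A_t_form_nonneg:
  assumes "0 < \<alpha>" "\<alpha> < 4/11" "0 \<le> \<sigma>"
  shows "0 \<le> (\<Sum>i<m. \<Sum>j<m. x i * (\<sigma> * A_t_entry \<alpha> i j) * x j)"
proof -
  have "(\<Sum>i<m. \<Sum>j<m. x i * (\<sigma> * A_t_entry \<alpha> i j) * x j) = \<sigma> * (\<Sum>i<m. \<Sum>j<m. x i * A_t_entry \<alpha> i j * x j)"
    by (simp add: sum_distrib_left mult_ac)
  then show ?thesis
    using quadratic_form_nonneg[of m "A_t_entry \<alpha>" x] A_t_entry_dominance assms by simp
qed

lemma A_t_accretive:
  assumes "0 < \<alpha>" "\<alpha> < 4/11" "0 \<le> \<sigma>" "2 \<le> M" and v: "v \<in> carrier_vec (M - 1)"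
  shows "0 \<le> scalar_prod v (A_t \<alpha> \<sigma> M *\<^sub>v v)"
proof -
  have "scalar_prod v (A_t \<alpha> \<sigma> M *\<^sub>v v) = (\<Sum>i<M - 1. \<Sum>j<M - 1. v $ i * (\<sigma> * A_t_entry \<alpha> i j) * v $ j)"
    unfolding quadratic_form_eq_sum[OF A_t_carrier[OF assms(4)] v]
    using assms(4) by (intro sum.cong refl) (simp add: A_t_index)
  then show ?thesis
    using A_t_form_nonneg[OF assms(1-3), where m = "M - 1" and x = "\<lambda>i. v $ i"] by simp
qed

section \<open>The fractional difference coefficients\<close>

lemma g_coeff_minus: "g_coeff \<beta> (- k) = g_coeff \<beta> k"
  by (simp add: g_coeff_def power_int_minus_one_minus mult_ac add_ac)

text \<open>
  The functional equation of the reciprocal Gamma function, applied in both factors of the denominator; it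
  has no exceptions at the poles of \<open>\<Gamma>\<close>.
\<close>

lemma g_coeff_Suc:
  "g_coeff \<beta> (int (Suc k)) * (real k + 1 + \<beta> / 2) = (real k - \<beta> / 2) * g_coeff \<beta> (int k)"
proof -
  define b where "b = \<beta> / 2"
  define A B C D where "A = rGamma (b - real k)" and "B = rGamma (b - real k + 1)"
    and "C = rGamma (b + real k + 1)" and "D = rGamma (b + real k + 1 + 1)"
  have rec: "A = (b - real k) * B" "C = (b + real k + 1) * D"
    unfolding A_def B_def C_def D_def by (rule rGamma_plus1[symmetric])+
  have shift: "b - real (Suc k) + 1 = b - real k" "b + real (Suc k) + 1 = b + real k + 1 + 1"
    by simp_all
  have gk: "g_coeff \<beta> (int k) = (-1) ^ k * Gamma (1 + \<beta>) * B * C"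
    by (simp add: g_coeff_def B_def C_def b_def)
  have gSk: "g_coeff \<beta> (int (Suc k)) = - ((-1) ^ k * Gamma (1 + \<beta>) * A * D)"
    unfolding g_coeff_def power_int_of_nat of_int_of_nat_eq b_def[symmetric] shift A_def D_def by simp
  show ?thesis
    unfolding gk gSk b_def[symmetric] rec by (simp add: algebra_simps)
qed

lemma g_coeff_0_pos:
  assumes "0 \<le> \<beta>" shows "0 < g_coeff \<beta> 0"
  using assms by (simp add: g_coeff_def rGamma_inverse_Gamma)

context
  fixes \<beta> :: real
  assumes \<beta>: "0 < \<beta>" "\<beta> \<le> 2"
begin

lemma g_coeff_1: "g_coeff \<beta> 1 = - (\<beta> / (2 + \<beta>)) * g_coeff \<beta> 0"
  using g_coeff_Suc[of \<beta> 0] \<beta> by (simp add: field_simps)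

lemma g_coeff_1_neg: "g_coeff \<beta> 1 < 0"
  using \<beta> g_coeff_0_pos[of \<beta>] by (simp add: g_coeff_1)

lemma g_coeff_Suc_eq: "g_coeff \<beta> (int (Suc k)) = (real k - \<beta> / 2) / (real k + 1 + \<beta> / 2) * g_coeff \<beta> (int k)"
proof -
  have "real k + 1 + \<beta> / 2 > 0" using \<beta> by (simp add: add_pos_nonneg)
  then show ?thesis
    using g_coeff_Suc[of \<beta> k] by (simp add: eq_divide_eq)
qed

lemma g_coeff_nonpos: "g_coeff \<beta> (int (Suc k)) \<le> 0"
proof (induction k)
  case 0
  then show ?case using g_coeff_1_neg by simp
next
  case (Suc k)
  have "0 \<le> (real (Suc k) - \<beta> / 2) / (real (Suc k) + 1 + \<beta> / 2)"
    using \<beta> by (intro divide_nonneg_pos) auto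
  then show ?case
    unfolding g_coeff_Suc_eq[of "Suc k"] using Suc by (rule mult_nonneg_nonpos)
qed

lemma g_coeff_Suc_ge: "g_coeff \<beta> (int (Suc k)) \<le> g_coeff \<beta> (int (Suc (Suc k)))"
proof -
  have r: "(real (Suc k) - \<beta> / 2) / (real (Suc k) + 1 + \<beta> / 2) \<le> 1"
    using \<beta> by (subst divide_le_eq_1_pos) auto
  show ?thesis
    unfolding g_coeff_Suc_eq[of "Suc k"]
    using mult_right_mono_neg[OF r g_coeff_nonpos[of k]] by (simp only: mult_1)
qed

lemma g_coeff_mono:
  assumes "1 \<le> k" "k \<le> l" shows "g_coeff \<beta> (int k) \<le> g_coeff \<beta> (int l)"
  using assms(2,1)
proof (induction rule: dec_induct)
  case (step n)
  then obtain n' where "n = Suc n'" by (cases n) auto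
  then show ?case using step g_coeff_Suc_ge[of n'] by simp
qed simp

lemma g_coeff_1_less_2: "g_coeff \<beta> 1 < g_coeff \<beta> 2"
proof -
  have "g_coeff \<beta> 2 = (1 - \<beta> / 2) / (2 + \<beta> / 2) * g_coeff \<beta> 1"
    using g_coeff_Suc_eq[of 1] by simp
  moreover have "(1 - \<beta> / 2) / (2 + \<beta> / 2) < 1" using \<beta> by simp
  from mult_strict_right_mono_neg[OF this g_coeff_1_neg]
  have "g_coeff \<beta> 1 < (1 - \<beta> / 2) / (2 + \<beta> / 2) * g_coeff \<beta> 1" by (simp only: mult_1)
  ultimately show ?thesis by (simp only:)
qed

text \<open>
  A closed form for the partial sums of the symmetric two-sided series, halved; its right-hand side is
  visibly nonnegative.
\<close>

lemma sum_g_coeff: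
  "g_coeff \<beta> 0 / 2 + (\<Sum>l=1..n. g_coeff \<beta> (int l)) = - g_coeff \<beta> (int (Suc n)) * (real n + 1 + \<beta> / 2) / \<beta>"
proof (induction n)
  case 0
  have "g_coeff \<beta> 1 * (1 + \<beta> / 2) = - \<beta> * (g_coeff \<beta> 0 / 2)"
    using g_coeff_Suc[of \<beta> 0] by simp
  then show ?case using \<beta> by simp
next
  case (Suc n)
  have "g_coeff \<beta> 0 / 2 + (\<Sum>l=1..Suc n. g_coeff \<beta> (int l))
     = - g_coeff \<beta> (int (Suc n)) * (real n + 1 + \<beta> / 2) / \<beta> + g_coeff \<beta> (int (Suc n))"
    using Suc by simp
  also have "\<dots> = - ((real (Suc n) - \<beta> / 2) * g_coeff \<beta> (int (Suc n))) / \<beta>"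
    using \<beta> by (simp add: field_simps)
  also have "\<dots> = - g_coeff \<beta> (int (Suc (Suc n))) * (real (Suc n) + 1 + \<beta> / 2) / \<beta>"
    using g_coeff_Suc[of \<beta> "Suc n"] by simp
  finally show ?case .
qed

lemma sum_abs_g_coeff_le: "(\<Sum>l=1..n. \<bar>g_coeff \<beta> (int l)\<bar>) \<le> g_coeff \<beta> 0 / 2"
proof -
  have "(\<Sum>l=1..n. \<bar>g_coeff \<beta> (int l)\<bar>) = (\<Sum>l=1..n. - g_coeff \<beta> (int l))"
  proof (rule sum.cong)
    fix l assume "l \<in> {1..n}"
    then show "\<bar>g_coeff \<beta> (int l)\<bar> = - g_coeff \<beta> (int l)"
      using g_coeff_nonpos[of "l - 1"] by simp
  qed simp
  moreover have "0 \<le> - g_coeff \<beta> (int (Suc n)) * (real n + 1 + \<beta> / 2) / \<beta>"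
    using g_coeff_nonpos[of n] \<beta> by (intro divide_nonneg_pos mult_nonneg_nonneg) auto
  ultimately show ?thesis
    using sum_g_coeff[of n] by (simp add: sum_negf)
qed

end

section \<open>The spatial matrices\<close>

definition G_entry :: "real \<Rightarrow> nat \<Rightarrow> nat \<Rightarrow> real" where
  "G_entry \<beta> i j = g_coeff \<beta> (int i - int j)"

definition H_entry :: "real \<Rightarrow> nat \<Rightarrow> nat \<Rightarrow> nat \<Rightarrow> real" where
  "H_entry \<beta> N i j =
    (if i + j + 4 \<le> N then g_coeff \<beta> (int (i + j + 2))
     else if i + j + 1 \<le> N then 0
     else g_coeff \<beta> (int (2 * N - (i + j + 2))))"

lemma G_entry_eq: "G_entry \<beta> i j = g_coeff \<beta> (int (if j \<le> i then i - j else j - i))"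
  using g_coeff_minus[of \<beta> "int j - int i"] by (auto simp: G_entry_def of_nat_diff)

lemma G_entry_sym: "G_entry \<beta> i j = G_entry \<beta> j i"
  by (simp add: G_entry_eq)

lemma H_entry_sym: "H_entry \<beta> N i j = H_entry \<beta> N j i"
  by (simp add: H_entry_def add_ac)

lemma G_beta_carrier: "G_beta \<beta> N \<in> carrier_mat (N - 1) (N - 1)"
  by (simp add: G_beta_def)

lemma G_tau_carrier: "G_tau \<beta> N \<in> carrier_mat (N - 1) (N - 1)"
  by (auto simp: G_tau_def H_beta_def)

lemma G_beta_index: "i < N - 1 \<Longrightarrow> j < N - 1 \<Longrightarrow> G_beta \<beta> N $$ (i, j) = G_entry \<beta> i j"
  by (simp add: G_beta_def G_entry_def)

lemma H_beta_index:
  assumes "i < N - 1" "j < N - 1"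
  shows "H_beta \<beta> N $$ (i, j) = H_entry \<beta> N i j"
proof -
  have "2 * int N - int (i + 1 + (j + 1)) = int (2 * N - (i + j + 2))"
    using assms by (simp add: of_nat_diff)
  then show ?thesis
    using assms by (auto simp: H_beta_def H_entry_def Let_def)
qed

lemma G_tau_index:
  assumes "i < N - 1" "j < N - 1"
  shows "G_tau \<beta> N $$ (i, j) = G_entry \<beta> i j - H_entry \<beta> N i j"
  using assms G_beta_index[OF assms] H_beta_index[OF assms]
  by (simp add: G_tau_def H_beta_def)

lemma G_beta_symmetric: "transpose_mat (G_beta \<beta> N) = G_beta \<beta> N"
  by (rule eq_matI) (auto simp: G_beta_def G_entry_sym[unfolded G_entry_def])

context
  fixes \<beta> :: real
  assumes \<beta>: "0 < \<beta>" "\<beta> \<le> 2"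
begin

lemma H_entry_nonpos:
  assumes "i < N - 1" "j < N - 1"
  shows "H_entry \<beta> N i j \<le> 0"
  using g_coeff_nonpos[OF \<beta>, of "i + j + 1"] g_coeff_nonpos[OF \<beta>, of "2 * N - (i + j + 3)"] assms
  by (auto simp: H_entry_def Suc_diff_Suc numeral_2_eq_2 numeral_3_eq_3)

lemma G_entry_le_H_entry:
  assumes "i < N - 1" "j < N - 1" "i \<noteq> j"
  shows "G_entry \<beta> i j \<le> H_entry \<beta> N i j"
proof -
  define d where "d = (if j \<le> i then i - j else j - i)"
  have d: "1 \<le> d" "G_entry \<beta> i j = g_coeff \<beta> (int d)" "d \<le> i + j" "d + i + j + 2 \<le> 2 * N"
    using assms by (auto simp: d_def G_entry_eq)
  show ?thesis
    unfolding d(2) H_entry_def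
    using g_coeff_nonpos[OF \<beta>, of "d - 1"] d(1,3,4)
      g_coeff_mono[OF \<beta>, of d "i + j + 2"] g_coeff_mono[OF \<beta>, of d "2 * N - (i + j + 2)"] by auto
qed

text \<open>
  In row \<open>i\<close> (counted from 0) the entries of \<open>G\<^sub>\<beta>\<close> to the left of the diagonal are \<open>g\<^sub>1, ..., g\<^sub>i\<close> and those of the upper
  Hankel triangle are \<open>g\<^sub>i\<^sub>+\<^sub>2, ..., g\<^sub>N\<^sub>-\<^sub>2\<close>: disjoint index ranges, so their absolute values add up to at most
  \<open>g\<^sub>0 / 2\<close>. The entries to the right of the diagonal, \<open>g\<^sub>1, ..., g\<^sub>N\<^sub>-\<^sub>2\<^sub>-\<^sub>i\<close>, and those of the lower Hankel
  triangle, \<open>g\<^sub>N\<^sub>-\<^sub>i, ..., g\<^sub>N\<^sub>-\<^sub>2\<close>, match in the same way. In row 0 the first pair leaves out \<open>g\<^sub>1\<close>.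
\<close>

lemma row_sum_G_H_le:
  assumes i: "i < N - 1"
  shows "(\<Sum>j\<in>{..<N - 1} - {i}. \<bar>G_entry \<beta> i j\<bar>) + (\<Sum>j<N - 1. \<bar>H_entry \<beta> N i j\<bar>)
     \<le> g_coeff \<beta> 0 - (if i = 0 then \<bar>g_coeff \<beta> 1\<bar> else 0)"
proof -
  define u where "u l = \<bar>g_coeff \<beta> (int l)\<bar>" for l :: nat
  have u: "0 \<le> u l" for l by (simp add: u_def)
  have split: "{..<N - 1} - {i} = {..<i} \<union> {i<..<N - 1}" using i by auto
  have "(\<Sum>j\<in>{..<N - 1} - {i}. \<bar>G_entry \<beta> i j\<bar>) = (\<Sum>j<i. u (i - j)) + (\<Sum>j\<in>{i<..<N - 1}. u (j - i))"
    unfolding split by (subst sum.union_disjoint) (auto simp: G_entry_eq u_def intro!: arg_cong2[where f = "(+)"] sum.cong)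
  also have "(\<Sum>j<i. u (i - j)) = (\<Sum>l=1..i. u l)"
    by (rule sum.reindex_bij_witness[of _ "\<lambda>l. i - l" "\<lambda>j. i - j"]) auto
  also have "(\<Sum>j\<in>{i<..<N - 1}. u (j - i)) = (\<Sum>l=1..N - 2 - i. u l)"
    by (rule sum.reindex_bij_witness[of _ "\<lambda>l. i + l" "\<lambda>j. j - i"]) auto
  finally have G: "(\<Sum>j\<in>{..<N - 1} - {i}. \<bar>G_entry \<beta> i j\<bar>) = (\<Sum>l=1..i. u l) + (\<Sum>l=1..N - 2 - i. u l)" .
  have "(\<Sum>j<N - 1. \<bar>H_entry \<beta> N i j\<bar>) = (\<Sum>j\<in>{j. i + j + 4 \<le> N} \<union> {j. N \<le> i + j \<and> j < N - 1}. \<bar>H_entry \<beta> N i j\<bar>)"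
    by (intro sum.mono_neutral_right) (auto simp: H_entry_def)
  also have "\<dots> = (\<Sum>j\<in>{j. i + j + 4 \<le> N}. \<bar>H_entry \<beta> N i j\<bar>) + (\<Sum>j\<in>{j. N \<le> i + j \<and> j < N - 1}. \<bar>H_entry \<beta> N i j\<bar>)"
    by (intro sum.union_disjoint) (auto intro: finite_subset[of _ "{..N}"])
  also have "(\<Sum>j\<in>{j. i + j + 4 \<le> N}. \<bar>H_entry \<beta> N i j\<bar>) = (\<Sum>l=i+2..N-2. u l)"
    by (rule sum.reindex_bij_witness[of _ "\<lambda>l. l - (i + 2)" "\<lambda>j. i + j + 2"]) (auto simp: H_entry_def u_def)
  also have "(\<Sum>j\<in>{j. N \<le> i + j \<and> j < N - 1}. \<bar>H_entry \<beta> N i j\<bar>) = (\<Sum>l=N-i..N-2. u l)"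
    by (rule sum.reindex_bij_witness[of _ "\<lambda>l. 2 * N - 2 - i - l" "\<lambda>j. 2 * N - 2 - i - j"])
      (use i in \<open>auto simp: H_entry_def u_def intro!: arg_cong[where f = "\<lambda>k. \<bar>g_coeff \<beta> k\<bar>"]\<close>)
  finally have H: "(\<Sum>j<N - 1. \<bar>H_entry \<beta> N i j\<bar>) = (\<Sum>l=i+2..N-2. u l) + (\<Sum>l=N-i..N-2. u l)" .
  have 1: "(\<Sum>l=1..i. u l) + (\<Sum>l=i+2..N-2. u l) \<le> g_coeff \<beta> 0 / 2 - (if i = 0 then u 1 else 0)"
  proof -
    have "(\<Sum>l=1..i. u l) + (\<Sum>l=i+2..N-2. u l) + (if i = 0 then u 1 else 0)
      = (\<Sum>l\<in>{1..i} \<union> {i+2..N-2} \<union> (if i = 0 then {1} else {}). u l)"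
      by (auto simp: sum.union_disjoint)
    also have "\<dots> \<le> (\<Sum>l=1..N. u l)"
      using i u by (intro sum_mono2) auto
    also have "\<dots> \<le> g_coeff \<beta> 0 / 2"
      unfolding u_def by (rule sum_abs_g_coeff_le[OF \<beta>])
    finally show ?thesis by simp
  qed
  have 2: "(\<Sum>l=1..N - 2 - i. u l) + (\<Sum>l=N-i..N-2. u l) \<le> g_coeff \<beta> 0 / 2"
  proof -
    have "(\<Sum>l=1..N - 2 - i. u l) + (\<Sum>l=N-i..N-2. u l) = (\<Sum>l\<in>{1..N-2-i} \<union> {N-i..N-2}. u l)"
      using i by (subst sum.union_disjoint) auto
    also have "\<dots> \<le> (\<Sum>l=1..N. u l)"
      using i u by (intro sum_mono2) auto
    also have "\<dots> \<le> g_coeff \<beta> 0 / 2"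
      unfolding u_def by (rule sum_abs_g_coeff_le[OF \<beta>])
    finally show ?thesis .
  qed
  show ?thesis
    using 1 2 unfolding G H by (auto simp: u_def)
qed

text \<open>
  The range of \<open>\<theta>\<close> is what \<open>G \<le> H \<le> 0\<close> off the diagonal allows: then
  \<open>\<bar>G + \<theta> H\<bar> \<le> \<bar>G\<bar> + \<bar>H\<bar>\<close> holds down to \<open>\<theta> = -3\<close>, since \<open>3 \<bar>H\<bar> - \<bar>G\<bar> \<le> \<bar>G\<bar> + \<bar>H\<bar>\<close>. The values \<open>1\<close> and \<open>-3\<close>
  give the two bounds on \<open>G\<^sub>\<beta>\<close> relative to \<open>G\<^sub>\<tau>\<close>, and \<open>-1\<close> is \<open>G\<^sub>\<tau>\<close> itself.
\<close>

lemma G_H_dominance: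
  assumes \<theta>: "-3 \<le> \<theta>" "\<theta> \<le> 1" and i: "i < N - 1"
  defines "C \<equiv> \<lambda>i j. G_entry \<beta> i j + \<theta> * H_entry \<beta> N i j"
  shows "(\<Sum>j\<in>{..<N - 1} - {i}. (\<bar>C i j\<bar> + \<bar>C j i\<bar>) / 2) + (if i = 0 then \<bar>g_coeff \<beta> 1\<bar> else 0) \<le> C i i"
proof -
  have "(\<Sum>j\<in>{..<N - 1} - {i}. (\<bar>C i j\<bar> + \<bar>C j i\<bar>) / 2) = (\<Sum>j\<in>{..<N - 1} - {i}. \<bar>C i j\<bar>)"
    by (simp add: C_def G_entry_sym[of \<beta> _ i] H_entry_sym[of \<beta> N _ i])
  also have "\<dots> \<le> (\<Sum>j\<in>{..<N - 1} - {i}. \<bar>G_entry \<beta> i j\<bar> + \<bar>H_entry \<beta> N i j\<bar>)"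
  proof (rule sum_mono)
    fix j assume j: "j \<in> {..<N - 1} - {i}"
    have g: "G_entry \<beta> i j \<le> H_entry \<beta> N i j" and h: "H_entry \<beta> N i j \<le> 0"
      using G_entry_le_H_entry[of i N j] H_entry_nonpos[of i N j] i j by auto
    have "\<theta> * H_entry \<beta> N i j \<le> - 3 * H_entry \<beta> N i j" "H_entry \<beta> N i j \<le> \<theta> * H_entry \<beta> N i j"
      using h \<theta> mult_right_mono_neg[of "- 3" \<theta> "H_entry \<beta> N i j"]
        mult_right_mono_neg[of \<theta> 1 "H_entry \<beta> N i j"] by simp_all
    then show "\<bar>C i j\<bar> \<le> \<bar>G_entry \<beta> i j\<bar> + \<bar>H_entry \<beta> N i j\<bar>"
      unfolding C_def using g h by linarith
  qed
  also have "\<dots> = (\<Sum>j\<in>{..<N - 1} - {i}. \<bar>G_entry \<beta> i j\<bar>) + (\<Sum>j<N - 1. \<bar>H_entry \<beta> N i j\<bar>) - \<bar>H_entry \<beta> N i i\<bar>"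
    using i by (simp add: sum.distrib sum_diff1)
  also have "\<dots> \<le> g_coeff \<beta> 0 - (if i = 0 then \<bar>g_coeff \<beta> 1\<bar> else 0) - \<bar>H_entry \<beta> N i i\<bar>"
    using row_sum_G_H_le[OF i] by simp
  also have "\<dots> \<le> C i i - (if i = 0 then \<bar>g_coeff \<beta> 1\<bar> else 0)"
  proof -
    have h: "H_entry \<beta> N i i \<le> 0" using H_entry_nonpos[of i N i] i by simp
    have "H_entry \<beta> N i i \<le> \<theta> * H_entry \<beta> N i i"
      using h \<theta> mult_right_mono_neg[of \<theta> 1 "H_entry \<beta> N i i"] by simp
    then show ?thesis using h by (simp add: C_def G_entry_def)
  qed
  finally show ?thesis by simp
qed

lemma G_H_form_nonneg:
  assumes \<theta>: "-3 \<le> \<theta>" "\<theta> \<le> 1"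
  shows "0 \<le> (\<Sum>i<N - 1. \<Sum>j<N - 1. x i * (G_entry \<beta> i j + \<theta> * H_entry \<beta> N i j) * x j)"
proof (rule quadratic_form_nonneg)
  fix i assume i: "i < N - 1"
  show "(\<Sum>j\<in>{..<N - 1} - {i}. (\<bar>G_entry \<beta> i j + \<theta> * H_entry \<beta> N i j\<bar> + \<bar>G_entry \<beta> j i + \<theta> * H_entry \<beta> N j i\<bar>) / 2)
     \<le> G_entry \<beta> i i + \<theta> * H_entry \<beta> N i i"
    using G_H_dominance[OF \<theta> i] by (auto split: if_splits)
qed

text \<open>
  Row 0 has the slack \<open>\<bar>g\<^sub>1\<bar>\<close>, and the entries next to the diagonal are \<open>g\<^sub>1\<close> minus a Hankel entry that is at
  least \<open>g\<^sub>2 > g\<^sub>1\<close>, so the chain of nonzero entries is unbroken.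
\<close>

lemma G_tau_form_pos:
  assumes k: "k < N - 1" "x k \<noteq> 0"
  shows "0 < (\<Sum>i<N - 1. \<Sum>j<N - 1. x i * (G_entry \<beta> i j - H_entry \<beta> N i j) * x j)"
proof (rule quadratic_form_pos[where k = k and x = x and A = "\<lambda>i j. G_entry \<beta> i j - H_entry \<beta> N i j"])
  fix i assume i: "i < N - 1"
  show "(\<Sum>j\<in>{..<N - 1} - {i}. (\<bar>G_entry \<beta> i j - H_entry \<beta> N i j\<bar> + \<bar>G_entry \<beta> j i - H_entry \<beta> N j i\<bar>) / 2)
     \<le> G_entry \<beta> i i - H_entry \<beta> N i i"
    using G_H_dominance[of "-1", OF _ _ i] by (auto split: if_splits)
next
  show "(\<Sum>j\<in>{..<N - 1} - {0}. (\<bar>G_entry \<beta> 0 j - H_entry \<beta> N 0 j\<bar> + \<bar>G_entry \<beta> j 0 - H_entry \<beta> N j 0\<bar>) / 2)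
     < G_entry \<beta> 0 0 - H_entry \<beta> N 0 0"
  proof -
    have "0 < N - 1" using k by simp
    from G_H_dominance[of "-1", OF _ _ this] show ?thesis
      using g_coeff_1_neg[OF \<beta>] by simp
  qed
next
  fix i assume i: "Suc i < N - 1"
  have "g_coeff \<beta> 2 \<le> H_entry \<beta> N i (Suc i)"
    using g_coeff_nonpos[OF \<beta>, of 1] g_coeff_mono[OF \<beta>, of 2 "i + Suc i + 2"] g_coeff_mono[OF \<beta>, of 2 "2 * N - (i + Suc i + 2)"] i
    by (auto simp: H_entry_def)
  moreover have "G_entry \<beta> i (Suc i) = g_coeff \<beta> 1" by (simp add: G_entry_eq)
  ultimately show "G_entry \<beta> i (Suc i) - H_entry \<beta> N i (Suc i) \<noteq> 0"
    using g_coeff_1_less_2[OF \<beta>] by simp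
qed (use k in auto)

text \<open>
  With \<open>G\<^sub>\<tau> = G - H\<close>, twice the differences of the two sides are the forms of \<open>G + H\<close> and \<open>G - 3 H\<close>.
\<close>

lemma G_beta_form_bounds:
  assumes v: "v \<in> carrier_vec (N - 1)"
  shows "scalar_prod v (G_tau \<beta> N *\<^sub>v v) / 2 \<le> scalar_prod v (G_beta \<beta> N *\<^sub>v v)"
    and "scalar_prod v (G_beta \<beta> N *\<^sub>v v) \<le> 3 / 2 * scalar_prod v (G_tau \<beta> N *\<^sub>v v)"
proof -
  define G H where "G = (\<Sum>i<N - 1. \<Sum>j<N - 1. v $ i * G_entry \<beta> i j * v $ j)"
    and "H = (\<Sum>i<N - 1. \<Sum>j<N - 1. v $ i * H_entry \<beta> N i j * v $ j)"
  have form_G: "scalar_prod v (G_beta \<beta> N *\<^sub>v v) = G"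
    unfolding quadratic_form_eq_sum[OF G_beta_carrier v] G_def
    by (intro sum.cong refl) (simp add: G_beta_index)
  have "scalar_prod v (G_tau \<beta> N *\<^sub>v v)
      = (\<Sum>i<N - 1. \<Sum>j<N - 1. v $ i * G_entry \<beta> i j * v $ j - v $ i * H_entry \<beta> N i j * v $ j)"
    unfolding quadratic_form_eq_sum[OF G_tau_carrier v]
    by (intro sum.cong refl) (simp add: G_tau_index algebra_simps)
  then have form_tau: "scalar_prod v (G_tau \<beta> N *\<^sub>v v) = G - H"
    by (simp add: sum_subtractf G_def H_def)
  have "0 \<le> G + \<theta> * H" if "-3 \<le> \<theta>" "\<theta> \<le> 1" for \<theta>
  proof -
    have "(\<Sum>i<N - 1. \<Sum>j<N - 1. v $ i * (G_entry \<beta> i j + \<theta> * H_entry \<beta> N i j) * v $ j) = G + \<theta> * H"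
      by (simp add: G_def H_def sum_distrib_left sum.distrib algebra_simps)
    then show ?thesis
      using G_H_form_nonneg[OF that, where N = N and x = "\<lambda>i. v $ i"] by simp
  qed
  from this[of 1] this[of "-3"]
  show "scalar_prod v (G_tau \<beta> N *\<^sub>v v) / 2 \<le> scalar_prod v (G_beta \<beta> N *\<^sub>v v)"
    "scalar_prod v (G_beta \<beta> N *\<^sub>v v) \<le> 3 / 2 * scalar_prod v (G_tau \<beta> N *\<^sub>v v)"
    unfolding form_G form_tau by simp_all
qed

lemma G_tau_sym_pos_def: "sym_pos_def (G_tau \<beta> N)"
proof -
  have "transpose_mat (G_tau \<beta> N) = G_tau \<beta> N"
  proof (rule eq_matI)
    fix i j assume "i < dim_row (G_tau \<beta> N)" "j < dim_col (G_tau \<beta> N)"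
    then show "transpose_mat (G_tau \<beta> N) $$ (i, j) = G_tau \<beta> N $$ (i, j)"
      using G_tau_carrier[of \<beta> N] G_entry_sym[of \<beta> i j] H_entry_sym[of \<beta> N i j] by (simp add: G_tau_index)
  qed (use G_tau_carrier[of \<beta> N] in auto)
  moreover have "0 < scalar_prod v (G_tau \<beta> N *\<^sub>v v)" if v: "v \<in> carrier_vec (N - 1)" "v \<noteq> 0\<^sub>v (N - 1)" for v
  proof -
    obtain k where "k < N - 1" "v $ k \<noteq> 0" using v by (auto simp: vec_eq_iff)
    then have "0 < (\<Sum>i<N - 1. \<Sum>j<N - 1. v $ i * (G_entry \<beta> i j - H_entry \<beta> N i j) * v $ j)"
      using G_tau_form_pos[where k = k and N = N and x = "\<lambda>i. v $ i"] by simp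
    also have "\<dots> = scalar_prod v (G_tau \<beta> N *\<^sub>v v)"
      unfolding quadratic_form_eq_sum[OF G_tau_carrier v(1)]
      by (intro sum.cong refl) (simp add: G_tau_index)
    finally show ?thesis .
  qed
  ultimately show ?thesis
    using G_tau_carrier[of \<beta> N] unfolding sym_pos_def_def by auto
qed

end

section \<open>The bound on the condition number\<close>

theorem theorem3p4:
  fixes \<alpha> \<beta> \<kappa> x\<^sub>L x\<^sub>R T h \<tau>\<^sub>t \<sigma> :: real
    and N M :: nat
    and At It Ix S Mtilde Pl Pr :: "real mat"
  assumes "0 < \<alpha>" "\<alpha> < 0.3624"
    and "1 < \<beta>" "\<beta> \<le> 2"
    and "0 < \<kappa>"
    and "x\<^sub>L < x\<^sub>R"
    and "0 < T"
    and "2 \<le> N" "2 \<le> M"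
    and "h = (x\<^sub>R - x\<^sub>L) / real N"
    and "\<tau>\<^sub>t = T / real M"
    and "\<sigma> = h powr \<beta> * \<tau>\<^sub>t powr (- \<alpha>) / Gamma (2 - \<alpha>)"
    and "At = A_t \<alpha> \<sigma> M"
    and "It = 1\<^sub>m (M - 1)"
    and "Ix = 1\<^sub>m (N - 1)"
    and "S = spd_sqrt (\<kappa> \<cdot>\<^sub>m G_tau \<beta> N)"
    and "Mtilde = kronecker (\<kappa> \<cdot>\<^sub>m G_beta \<beta> N) It + kronecker Ix At"
    and "Pl = kronecker (matrix_inverse S) At + kronecker S It"
    and "Pr = kronecker S It"
  shows "invertible_mat (matrix_inverse Pl * Mtilde * matrix_inverse Pr) \<and>
         condition_number (matrix_inverse Pl * Mtilde * matrix_inverse Pr) < 2 * sqrt 3"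
proof -
  define n where "n = N - 1"
  have \<beta>: "0 < \<beta>" "\<beta> \<le> 2" using assms(3,4) by simp_all
  have \<alpha>: "0 < \<alpha>" "\<alpha> < 4/11" using assms(1,2) by simp_all
  have \<sigma>: "0 \<le> \<sigma>"
    unfolding assms(12) using \<alpha> by (intro divide_nonneg_pos mult_nonneg_nonneg) auto
  have G: "\<kappa> \<cdot>\<^sub>m G_beta \<beta> N \<in> carrier_mat n n" and K: "\<kappa> \<cdot>\<^sub>m G_tau \<beta> N \<in> carrier_mat n n"
    using G_beta_carrier G_tau_carrier by (simp_all add: n_def)
  have "sym_pos_def (\<kappa> \<cdot>\<^sub>m G_tau \<beta> N)"
    using sym_pos_def_smult[OF G_tau_carrier G_tau_sym_pos_def[OF \<beta>]] assms(5) .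
  note S = spd_sqrt_properties[OF K this, folded assms(16)]
  have symG: "transpose_mat (\<kappa> \<cdot>\<^sub>m G_beta \<beta> N) = \<kappa> \<cdot>\<^sub>m G_beta \<beta> N"
  proof -
    have "transpose_mat (\<kappa> \<cdot>\<^sub>m G_beta \<beta> N) = \<kappa> \<cdot>\<^sub>m transpose_mat (G_beta \<beta> N)" by (rule eq_matI) auto
    then show ?thesis by (simp add: G_beta_symmetric)
  qed
  have A: "At \<in> carrier_mat (M - 1) (M - 1)" using A_t_carrier assms(9,13) by simp
  have lower: "scalar_prod v ((\<kappa> \<cdot>\<^sub>m G_tau \<beta> N) *\<^sub>v v) / 2 \<le> scalar_prod v ((\<kappa> \<cdot>\<^sub>m G_beta \<beta> N) *\<^sub>v v)"
    and upper: "scalar_prod v ((\<kappa> \<cdot>\<^sub>m G_beta \<beta> N) *\<^sub>v v) \<le> 3 / 2 * scalar_prod v ((\<kappa> \<cdot>\<^sub>m G_tau \<beta> N) *\<^sub>v v)"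
    if "v \<in> carrier_vec n" for v
    using G_beta_form_bounds[OF \<beta>, of v N, THEN mult_left_mono, of \<kappa>] that assms(5)
    by (simp_all add: n_def smult_form[OF G_beta_carrier] smult_form[OF G_tau_carrier])
  have acc: "0 \<le> scalar_prod v (At *\<^sub>v v)" if "v \<in> carrier_vec (M - 1)" for v
    unfolding assms(13) by (rule A_t_accretive[OF \<alpha> \<sigma> assms(9) that])
  note main = preconditioned_condition[OF G symG S A lower upper acc]
  have "(3::real) < 2 * sqrt 3"
    using real_less_rsqrt[of "3/2" 3] by (simp add: power2_eq_square)
  then show ?thesis
    using main unfolding assms(14,15,17,18,19) n_def by (simp add: order_le_less_trans)
qed

end
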